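(* Let $a,b,p>0$ and $s\geq 1$, and consider the system $$\Delta u= |x|^{a}v^p,\qquad \Delta v= |x|^{b}|\nabla u|^s\qquad\text{in } \mathbb{R}^N. \qquad (S)$$ 1. System $(S)$ has positive radial solutions if and only if $ps-1\leq 0$. 2. Assume $p<1$ and $ps<1$. Let $(u,v)$ be a positive radially symmetric solution of $(S)$. If $$\frac{p(s-2)(s+as+b+2)}{1-ps} \leq 2(N+a-1),$$ then $$\lim_{|x|\rightarrow \infty}\frac{u(x)}{|x|^{\frac{(a+2)(1-ps)+ ps(a+1)+bp+2p}{1-ps}}}= \frac{(AB^s K)^{\frac{p}{ps - 1}}}{DB}$$ and $$\lim_{|x|\rightarrow \infty}\frac{v(x)}{|x|^{\frac{(a+1)s + b + 2}{1-ps}}}= (AB^s K)^{\frac{1}{ps - 1}},$$ where $$A = 2 + \frac{b+s(1+a+2p)}{1-ps},\qquad B = N+a + p\left(2+\frac{b+s(1+a+2p)}{1-ps}\right),$$ $$K = N + \frac{b+s(1+a+2p)}{1-ps},\qquad D = 2+a + p\left(2+\frac{b+s(1+a+2p)}{1-ps}\right).$$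
   Context: A positive radial solution is a pair $(u,v)$ of positive, radially symmetric (classical) functions on all of $\mathbb{R}^N$ satisfying the system. *)

theory Defs
  imports "HOL-Analysis.Analysis"
begin

definition partial :: "'a \<Rightarrow> ('a::euclidean_space \<Rightarrow> real) \<Rightarrow> 'a \<Rightarrow> real" where
  "partial e f x = frechet_derivative f (at x) e"

definition gradient :: "('a::euclidean_space \<Rightarrow> real) \<Rightarrow> 'a \<Rightarrow> 'a" where
  "gradient f x = (\<Sum>e\<in>Basis. partial e f x *\<^sub>R e)"

definition laplacian :: "('a::euclidean_space \<Rightarrow> real) \<Rightarrow> 'a \<Rightarrow> real" where
  "laplacian f x = (\<Sum>e\<in>Basis. partial e (partial e f) x)"

definition C1_function :: "('a::euclidean_space \<Rightarrow> real) \<Rightarrow> bool" where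
  "C1_function f \<longleftrightarrow>
     (\<forall>x. f differentiable (at x)) \<and> (\<forall>e\<in>Basis. continuous_on UNIV (partial e f))"

definition C2_function :: "('a::euclidean_space \<Rightarrow> real) \<Rightarrow> bool" where
  "C2_function f \<longleftrightarrow> C1_function f \<and> (\<forall>e\<in>Basis. C1_function (partial e f))"

lemma GDERIV_gradient:
  assumes "f differentiable (at x)"
  shows "GDERIV f x :> gradient f x"
proof -
  let ?f' = "frechet_derivative f (at x)"
  have d: "(f has_derivative ?f') (at x)"
    using assms by (simp add: frechet_derivative_works)
  then interpret linear ?f'
    by (rule has_derivative_linear)
  have "?f' h = h \<bullet> gradient f x" for h
  proof -
    have "?f' h = ?f' (\<Sum>e\<in>Basis. (h \<bullet> e) *\<^sub>R e)"
      by (simp add: euclidean_representation)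
    also have "\<dots> = (\<Sum>e\<in>Basis. (h \<bullet> e) * ?f' e)"
      by (simp add: sum scale)
    finally show ?thesis
      by (simp add: gradient_def partial_def inner_sum_right mult.commute)
  qed
  then have "?f' = (\<lambda>h. h \<bullet> gradient f x)" ..
  with d show ?thesis
    unfolding gderiv_def by simp
qed

definition radially_symmetric :: "('a::euclidean_space \<Rightarrow> real) \<Rightarrow> bool" where
  "radially_symmetric f \<longleftrightarrow> (\<forall>x y. norm x = norm y \<longrightarrow> f x = f y)"

(* "Classical" means twice continuously differentiable on the whole space, origin included:
   since a, b > 0, the weights |x|^a, |x|^b are continuous and vanish at 0, in accordance
   with 0 powr a = 0, so the equations are imposed at the origin as well. *)
definition positive_radial_solution ::
  "real \<Rightarrow> real \<Rightarrow> real \<Rightarrow> real \<Rightarrow>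
     ('a::euclidean_space \<Rightarrow> real) \<Rightarrow> ('a \<Rightarrow> real) \<Rightarrow> bool" where
  "positive_radial_solution a b p s u v \<longleftrightarrow>
     C2_function u \<and> C2_function v \<and>
     radially_symmetric u \<and> radially_symmetric v \<and>
     (\<forall>x. u x > 0) \<and> (\<forall>x. v x > 0) \<and>
     (\<forall>x. laplacian u x = norm x powr a * v x powr p) \<and>
     (\<forall>x. laplacian v x = norm x powr b * norm (gradient u x) powr s)"

end

theory Submission
  imports Defs
begin

text \<open>With $w = u'$ the system is a monotone integral equation $v = v(0) + T v$ on $[0, \infty)$,
  where $T$ is homogeneous of degree $ps$.
  Solutions satisfy $v(r + 3h) \geq \kappa h^{2+s} r^{b+as} v(r)^{ps}$ for $h \leq r$.
  If $ps > 1$, using this with $h = 2^{-j}$ makes $v$ infinite at a finite radius.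
  If $ps \leq 1$, the function $\exp(r^c / c)$ with
  $c = 2 + b + s(1 + a)$ is a super-solution, and monotonicity of $T$ gives a solution below it.
  If $ps < 1$, then $T v \leq r^c v^{ps}$ and the inequality with $h = r$ bound $v / r^\sigma$
  from above and from below, $\sigma = c / (1 - ps)$. With $L r^\sigma$ the fixed point of $T$,
  applying $T$ to an eventual bound $L m r^\sigma$ replaces $m$ by $m^{ps}$ up to an arbitrarily small
  error, and the iterates of $m \mapsto m^{ps}$
  tend to $1$.\<close>

section \<open>Calculus of radial functions\<close>

text \<open>The radial equations are singular at 0 and their nonlinearities need not be Lipschitz,
  so existence is based on order rather than on contraction. A supremum of monotone sub-solutions
  has no regularity of its own, but integrals of monotone functions exist and are continuous, so the
  fixed-point equation itself supplies the regularity. The super-solution solves V' = r^(c-1) V,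
  V(0) = 1, the linear equation that remains once V^(ps) <= V is used. In the blow-up argument the
  intervals have summable length, while h^(2+s) costs a factor 2^(-(2+s)j); because ps > 1,
  geometric growth of v repays it. In the asymptotics the obstacle is the integration constants:
  they make each application of T inexact, and v / r^\<sigma> is not known to be monotone or to
  converge. Each integration is therefore given a factor \<theta> of slack. The losses do not
  accumulate, since in terms of log m one round is a contraction with factor ps < 1; the total loss
  is a power of \<theta> and disappears as \<theta> tends to 1.\<close>

lemma partial_eqI: "(f has_derivative f') (at x) \<Longrightarrow> partial e f x = f' e"
  by (simp add: partial_def frechet_derivative_at[symmetric])

lemma has_derivative_eq_on_open:
  assumes "open S" "x \<in> S" "\<And>y. y \<in> S \<Longrightarrow> f y = g y" "(g has_derivative g') (at x)"
  shows "(f has_derivative g') (at x)"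
  using has_derivative_transform_within_open[of g g' x UNIV S f] assms by auto

lemma has_derivative_radial:
  fixes x :: "'a::euclidean_space"
  assumes "x \<noteq> 0" "(\<phi> has_real_derivative d) (at (norm x))"
  shows "((\<lambda>x. \<phi> (norm x)) has_derivative (\<lambda>h. d * (x \<bullet> h / norm x))) (at x)"
proof -
  have "(norm has_derivative (\<lambda>h. x \<bullet> h / norm x)) (at x)"
    using has_derivative_norm[OF assms(1)] 
    by (rule has_derivative_eq_rhs) (simp add: sgn_div_norm divide_inverse fun_eq_iff inner_commute)
  from has_derivative_compose[OF this has_field_derivative_imp_has_derivative[OF assms(2)]]
  show ?thesis by (simp add: mult.commute)
qed

lemma partial_radial:
  fixes x :: "'a::euclidean_space"
  assumes "x \<noteq> 0" "(\<phi> has_real_derivative d) (at (norm x))"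
  shows "partial e (\<lambda>x. \<phi> (norm x)) x = d / norm x * (x \<bullet> e)"
  by (simp add: partial_eqI[OF has_derivative_radial[OF assms]])

text \<open>Off the origin the partial derivative is the radial function
  \<open>\<phi>1 r / r\<close> times the linear form \<open>x \<bullet> e\<close>; the formula is
  the product rule for these two factors.\<close>

lemma has_derivative_partial_radial:
  fixes x :: "'a::euclidean_space"
  assumes "\<And>r. r > 0 \<Longrightarrow> (\<phi> has_real_derivative \<phi>1 r) (at r)"
    and "(\<phi>1 has_real_derivative d) (at (norm x))" and "x \<noteq> 0"
  shows "(partial e (\<lambda>x. \<phi> (norm x)) has_derivative
    (\<lambda>h. (d - \<phi>1 (norm x) / norm x) * (x \<bullet> h) * (x \<bullet> e) / (norm x)\<^sup>2
         + \<phi>1 (norm x) / norm x * (h \<bullet> e))) (at x)"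
proof (rule has_derivative_eq_on_open[where S = "- {0}"])
  have "((\<lambda>r. \<phi>1 r / r) has_real_derivative (d - \<phi>1 (norm x) / norm x) / norm x) (at (norm x))"
    using assms by (auto intro!: derivative_eq_intros simp: field_simps)
  from has_derivative_radial[OF assms(3) this]
  show "((\<lambda>x. \<phi>1 (norm x) / norm x * (x \<bullet> e)) has_derivative
    (\<lambda>h. (d - \<phi>1 (norm x) / norm x) * (x \<bullet> h) * (x \<bullet> e) / (norm x)\<^sup>2
         + \<phi>1 (norm x) / norm x * (h \<bullet> e))) (at x)"
    by (rule has_derivative_eq_rhs[OF has_derivative_mult[OF _ has_derivative_inner_left[OF has_derivative_ident]]])
      (simp add: fun_eq_iff power2_eq_square algebra_simps diff_divide_distrib)
qed (use assms(3) in \<open>auto simp: partial_radial[OF _ assms(1)]\<close>)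

text \<open>Trace of the Hessian: by Parseval the rank-one part contributes once, the multiple of
  the identity \<open>DIM('a)\<close> times.\<close>

lemma laplacian_radial:
  fixes x :: "'a::euclidean_space"
  assumes "\<And>r. r > 0 \<Longrightarrow> (\<phi> has_real_derivative \<phi>1 r) (at r)"
    and "(\<phi>1 has_real_derivative d) (at (norm x))" and "x \<noteq> 0"
  shows "laplacian (\<lambda>x. \<phi> (norm x)) x = d + (real DIM('a) - 1) * \<phi>1 (norm x) / norm x"
proof -
  have "laplacian (\<lambda>x. \<phi> (norm x)) x =
    (\<Sum>e\<in>Basis. (d - \<phi>1 (norm x) / norm x) / (norm x)\<^sup>2 * (x \<bullet> e)\<^sup>2 + \<phi>1 (norm x) / norm x * (e \<bullet> e))"
    unfolding laplacian_def
    by (intro sum.cong refl) (simp add: partial_eqI[OF has_derivative_partial_radial[OF assms]] power2_eq_square)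
  also have "\<dots> = (d - \<phi>1 (norm x) / norm x) / (norm x)\<^sup>2 * (\<Sum>e\<in>Basis. (x \<bullet> e)\<^sup>2)
      + \<phi>1 (norm x) / norm x * real DIM('a)"
    by (simp add: sum.distrib sum_distrib_left inner_same_Basis)
  also have "(\<Sum>e\<in>Basis. (x \<bullet> e)\<^sup>2) = (norm x)\<^sup>2"
    unfolding power2_norm_eq_inner by (subst euclidean_inner) (simp add: power2_eq_square)
  finally show ?thesis using assms(3) by (simp add: divide_simps) (simp add: algebra_simps)
qed

lemma norm_gradient_radial:
  fixes x :: "'a::euclidean_space"
  assumes "x \<noteq> 0" "(\<phi> has_real_derivative d) (at (norm x))"
  shows "norm (gradient (\<lambda>x. \<phi> (norm x)) x) = \<bar>d\<bar>"
proof -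
  have "gradient (\<lambda>x. \<phi> (norm x)) x = (d / norm x) *\<^sub>R x"
    unfolding gradient_def partial_radial[OF assms]
    using scaleR_sum_right[of "d / norm x" "\<lambda>e. (x \<bullet> e) *\<^sub>R e" Basis]
    by (simp add: euclidean_representation)
  then show ?thesis using assms(1) by simp
qed

lemma has_real_derivative_along_axis:
  fixes f :: "'a::euclidean_space \<Rightarrow> real"
  assumes "f differentiable (at (r *\<^sub>R e))"
  shows "((\<lambda>r. f (r *\<^sub>R e)) has_real_derivative partial e f (r *\<^sub>R e)) (at r)"
proof -
  let ?D = "frechet_derivative f (at (r *\<^sub>R e))"
  have D: "(f has_derivative ?D) (at (r *\<^sub>R e))"
    using assms by (simp add: frechet_derivative_works)
  have "((\<lambda>r. r *\<^sub>R e) has_derivative (\<lambda>h. h *\<^sub>R e)) (at r)"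
    by (auto intro!: derivative_eq_intros)
  from has_derivative_compose[OF this D]
  have "((\<lambda>r. f (r *\<^sub>R e)) has_derivative (\<lambda>h. ?D (h *\<^sub>R e))) (at r)" .
  moreover have "?D (h *\<^sub>R e) = partial e f (r *\<^sub>R e) * h" for h
    using linear_scale[OF has_derivative_linear[OF D]] by (simp add: partial_def)
  ultimately show ?thesis by (simp add: has_field_derivative_def)
qed

text \<open>Off the origin the profile is differentiated through the norm, at the origin the
  derivatives vanish because $\phi'(r) = o(r)$ and $\phi''(r) = o(1)$.\<close>

lemma radial_extension:
  fixes \<phi> \<phi>1 \<phi>2 :: "real \<Rightarrow> real"
  assumes d1: "\<And>r. r > 0 \<Longrightarrow> (\<phi> has_real_derivative \<phi>1 r) (at r)"
    and d2: "\<And>r. r > 0 \<Longrightarrow> (\<phi>1 has_real_derivative \<phi>2 r) (at r)"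
    and c2: "continuous_on {0<..} \<phi>2"
    and l0: "(\<phi> \<longlongrightarrow> \<phi> 0) (at_right 0)"
    and l1: "((\<lambda>r. \<phi>1 r / r) \<longlongrightarrow> 0) (at_right 0)"
    and l2: "(\<phi>2 \<longlongrightarrow> 0) (at_right 0)"
  defines "f \<equiv> (\<lambda>x::'a::euclidean_space. \<phi> (norm x))"
  shows "C2_function f" "laplacian f 0 = 0" "gradient f 0 = 0"
proof -
  have nz: "filterlim (norm :: 'a \<Rightarrow> real) (at_right 0) (at 0)"
    unfolding filterlim_at by (auto intro!: tendsto_eq_intros eventually_at_topological[THEN iffD2] exI[of _ UNIV])
  have L1: "((\<lambda>x::'a. \<phi>1 (norm x) / norm x) \<longlongrightarrow> 0) (at 0)"
    using filterlim_compose[OF l1 nz] .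
  have L2: "((\<lambda>x::'a. \<phi>2 (norm x)) \<longlongrightarrow> 0) (at 0)"
    using filterlim_compose[OF l2 nz] .
  \<comment> \<open>L'Hopital gives \<open>\<phi> r - \<phi> 0 = o(r)\<close>, so the extension has
    derivative 0 at the origin.\<close>
  have q0: "((\<lambda>r. (\<phi> r - \<phi> 0) / r) \<longlongrightarrow> 0) (at_right 0)"
  proof (rule lhopital_right_0)
    show "((\<lambda>r. \<phi> r - \<phi> 0) \<longlongrightarrow> 0) (at_right 0)"
      using tendsto_diff[OF l0 tendsto_const[of "\<phi> 0"]] by simp
    have "((\<lambda>r. \<phi>1 r / r * r) \<longlongrightarrow> 0 * 0) (at_right 0)"
      by (intro tendsto_mult l1 tendsto_ident_at)
    then show "((\<lambda>r. \<phi>1 r / 1) \<longlongrightarrow> 0) (at_right 0)"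
      by (elim Lim_transform_eventually[THEN tendsto_eq_rhs])
        (auto simp: eventually_at_right_field intro!: exI[of _ 1])
  qed (auto simp: eventually_at_right_field intro!: exI[of _ 1] derivative_eq_intros d1)
  have D0: "(f has_derivative (\<lambda>h. 0)) (at 0)"
    unfolding has_derivative_at
  proof (intro conjI bounded_linear_zero)
    have "((\<lambda>h::'a. norm ((\<phi> (norm h) - \<phi> 0) / norm h)) \<longlongrightarrow> 0) (at 0)"
      using filterlim_compose[OF q0 nz] by (rule tendsto_norm_zero)
    then show "(\<lambda>h. norm (f (0 + h) - f 0 - 0) / norm h) \<midarrow>0\<rightarrow> 0"
      by (simp add: f_def)
  qed
  have P0: "partial e f 0 = 0" for e using partial_eqI[OF D0] .
  have P: "partial e f x = \<phi>1 (norm x) / norm x * (x \<bullet> e)" if "x \<noteq> 0" for e x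
    unfolding f_def using partial_radial[OF that d1] that by simp
  have DP: "(partial e f has_derivative
    (\<lambda>h. (\<phi>2 (norm x) - \<phi>1 (norm x) / norm x) * (x \<bullet> h) * (x \<bullet> e) / (norm x)\<^sup>2
         + \<phi>1 (norm x) / norm x * (h \<bullet> e))) (at x)" if "x \<noteq> 0" for e x
    unfolding f_def using has_derivative_partial_radial[OF d1 d2] that by auto
  have DP0: "(partial e f has_derivative (\<lambda>h. 0)) (at 0)" if "e \<in> Basis" for e
    unfolding has_derivative_at
  proof (intro conjI bounded_linear_zero)
    have "\<forall>\<^sub>F h in at (0::'a). norm (norm (partial e f (0 + h) - partial e f 0 - 0) / norm h) \<le> norm (\<phi>1 (norm h) / norm h) * 1"
      unfolding eventually_at_topological
    proof (intro exI[of _ UNIV] conjI ballI impI)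
      fix h :: 'a assume "h \<noteq> 0"
      have "\<bar>h \<bullet> e\<bar> \<le> norm h" using Basis_le_norm[OF that] .
      then show "norm (norm (partial e f (0 + h) - partial e f 0 - 0) / norm h) \<le> norm (\<phi>1 (norm h) / norm h) * 1"
        using \<open>h \<noteq> 0\<close> by (simp add: P P0 abs_mult field_simps mult_right_mono)
    qed auto
    from tendsto_0_le[OF L1 this]
    show "(\<lambda>h. norm (partial e f (0 + h) - partial e f 0 - 0) / norm h) \<midarrow>0\<rightarrow> 0" .
  qed
  have PP0: "partial e' (partial e f) 0 = 0" if "e \<in> Basis" for e e'
    using partial_eqI[OF DP0[OF that]] .
  show "laplacian f 0 = 0" by (simp add: laplacian_def PP0)
  show "gradient f 0 = 0" by (simp add: gradient_def P0)
  have df: "f differentiable (at x)" for x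
  proof (cases "x = 0")
    case False
    then show ?thesis
      unfolding f_def using has_derivative_radial[OF False d1] by (auto intro: differentiableI)
  qed (use D0 in \<open>auto intro: differentiableI\<close>)
  have dP: "partial e f differentiable (at x)" if "e \<in> Basis" for e x
    using DP[of x e] DP0[OF that] by (cases "x = 0") (auto intro: differentiableI)
  have cPP: "continuous (at x) (partial e' (partial e f))" if "e \<in> Basis" "e' \<in> Basis" for e e' x
  proof (cases "x = 0")
    case True
    \<comment> \<open>A Hessian entry is \<open>\<phi>2 - q\<close> times two direction cosines plus
      \<open>q\<close> times an entry of the identity, where \<open>q = \<phi>1 / r\<close>; all
      these factors are at most 1 in modulus.\<close>
    let ?G = "\<lambda>h::'a. \<bar>\<phi>2 (norm h)\<bar> + \<bar>\<phi>1 (norm h) / norm h\<bar> + \<bar>\<phi>1 (norm h) / norm h\<bar>"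
    have "((\<lambda>h. ?G h) \<longlongrightarrow> 0) (at 0)"
      using tendsto_add[OF tendsto_add[OF tendsto_rabs_zero[OF L2] tendsto_rabs_zero[OF L1]] tendsto_rabs_zero[OF L1]]
      by simp
    moreover have "\<forall>\<^sub>F h in at (0::'a). norm (partial e' (partial e f) h) \<le> norm (?G h) * 1"
      unfolding eventually_at_topological
    proof (intro exI[of _ UNIV] conjI ballI impI)
      fix h :: 'a assume h: "h \<noteq> 0"
      let ?q = "\<phi>1 (norm h) / norm h"
      have A: "\<bar>h \<bullet> e\<bar> \<le> norm h" "\<bar>h \<bullet> e'\<bar> \<le> norm h" "\<bar>e' \<bullet> e\<bar> \<le> 1"
        using Basis_le_norm that by (auto simp: inner_Basis)
      have "partial e' (partial e f) h = (\<phi>2 (norm h) - ?q) * ((h \<bullet> e') * (h \<bullet> e) / (norm h)\<^sup>2) + ?q * (e' \<bullet> e)"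
        using partial_eqI[OF DP[OF h]] by simp
      also have "\<bar>\<dots>\<bar> \<le> \<bar>\<phi>2 (norm h) - ?q\<bar> * \<bar>(h \<bullet> e') * (h \<bullet> e) / (norm h)\<^sup>2\<bar> + \<bar>?q\<bar> * \<bar>e' \<bullet> e\<bar>"
        by (simp only: abs_mult[symmetric] abs_triangle_ineq)
      also have "\<dots> \<le> \<bar>\<phi>2 (norm h) - ?q\<bar> * 1 + \<bar>?q\<bar> * 1"
      proof (intro add_mono mult_left_mono)
        have "\<bar>(h \<bullet> e') * (h \<bullet> e)\<bar> \<le> norm h * norm h"
          unfolding abs_mult using A by (intro mult_mono) auto
        then show "\<bar>(h \<bullet> e') * (h \<bullet> e) / (norm h)\<^sup>2\<bar> \<le> 1"
          using h by (simp add: power2_eq_square abs_mult)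
      qed (use A in auto)
      also have "\<dots> \<le> ?G h" using abs_triangle_ineq4[of "\<phi>2 (norm h)" ?q] by simp
      finally show "norm (partial e' (partial e f) h) \<le> norm (?G h) * 1" by simp
    qed auto
    ultimately have "(partial e' (partial e f) \<longlongrightarrow> 0) (at 0)" by (rule tendsto_0_le)
    then show ?thesis using True PP0[OF that(1)] by (simp add: isCont_def)
  next
    case False
    have i2: "isCont \<phi>2 r" if "r > 0" for r
      using c2 that by (simp add: continuous_on_eq_continuous_at)
    have i1: "isCont \<phi>1 r" if "r > 0" for r using d2[OF that] by (rule DERIV_isCont)
    have *: "isCont (\<lambda>x. \<phi>2 (norm x)) x" "isCont (\<lambda>x. \<phi>1 (norm x)) x"
      using False i1 i2 by (auto intro!: isCont_o2[where f = norm] continuous_intros)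
    let ?g = "\<lambda>x. (\<phi>2 (norm x) - \<phi>1 (norm x) / norm x) * (x \<bullet> e') * (x \<bullet> e) / (norm x)\<^sup>2
         + \<phi>1 (norm x) / norm x * (e' \<bullet> e)"
    have "isCont ?g x" using False by (intro continuous_intros *) auto
    moreover have "\<forall>\<^sub>F y in nhds x. partial e' (partial e f) y = ?g y"
      unfolding eventually_nhds
    proof (intro exI[of _ "- {0}"] conjI ballI)
      fix y :: 'a assume "y \<in> - {0}"
      then show "partial e' (partial e f) y = ?g y" using partial_eqI[OF DP[of y]] by simp
    qed (use False in auto)
    ultimately show ?thesis by (simp add: isCont_cong)
  qed
  show "C2_function f"
    unfolding C2_function_def C1_function_def
    using df dP cPP by (auto intro!: continuous_at_imp_continuous_on intro: differentiable_imp_continuous_within)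
qed

text \<open>Along a coordinate axis the profile lives on the whole line, so it is differentiable at
  0 as well. The weight \<open>r ^ n\<close> absorbs the first-order term
  \<open>n * \<phi>1 r / r\<close> of the radial Laplacian.\<close>

lemma radial_profile:
  fixes f :: "'a::euclidean_space \<Rightarrow> real"
  assumes C2: "C2_function f" and rad: "radially_symmetric f" and e: "e \<in> Basis"
    and n: "DIM('a) = Suc n"
  defines "\<phi>1 \<equiv> \<lambda>r. partial e f (r *\<^sub>R e)"
  shows "f x = f (norm x *\<^sub>R e)"
    and "((\<lambda>r. f (r *\<^sub>R e)) has_real_derivative \<phi>1 r) (at r)"
    and "(\<phi>1 \<longlongrightarrow> 0) (at_right 0)"
    and "r > 0 \<Longrightarrow> ((\<lambda>r. r ^ n * \<phi>1 r) has_real_derivative r ^ n * laplacian f (r *\<^sub>R e)) (at r)"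
    and "r > 0 \<Longrightarrow> norm (gradient f (r *\<^sub>R e)) = \<bar>\<phi>1 r\<bar>"
proof -
  have norm_e: "norm e = 1" using e by (rule norm_Basis)
  have rad': "f x = f y" if "norm x = norm y" for x y
    using rad that unfolding radially_symmetric_def by blast
  have f: "f x = f (norm x *\<^sub>R e)" for x
    by (rule rad') (simp add: norm_e)
  show "f x = f (norm x *\<^sub>R e)" by (rule f)
  have f_eq: "f = (\<lambda>x. f (norm x *\<^sub>R e))" by (rule ext) (rule f)
  show d1: "((\<lambda>r. f (r *\<^sub>R e)) has_real_derivative \<phi>1 r) (at r)" for r
    unfolding \<phi>1_def using C2
    by (intro has_real_derivative_along_axis) (simp add: C2_function_def C1_function_def)
  have d2: "(\<phi>1 has_real_derivative partial e (partial e f) (r *\<^sub>R e)) (at r)" for r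
    unfolding \<phi>1_def using C2 e
    by (intro has_real_derivative_along_axis) (simp add: C2_function_def C1_function_def)
  \<comment> \<open>The profile is even, so its derivative at 0 equals its own negative.\<close>
  have "\<phi>1 0 = 0"
  proof -
    have "((\<lambda>r. f ((- r) *\<^sub>R e)) has_real_derivative - \<phi>1 (- 0)) (at 0)"
      using d1[of "- 0"] by (simp only: DERIV_mirror)
    moreover have "f ((- r) *\<^sub>R e) = f (r *\<^sub>R e)" for r
      by (rule rad') simp
    ultimately have "((\<lambda>r. f (r *\<^sub>R e)) has_real_derivative - \<phi>1 0) (at 0)" by simp
    from DERIV_unique[OF this d1] show ?thesis by simp
  qed
  moreover have "(\<phi>1 \<longlongrightarrow> \<phi>1 0) (at_right 0)"
    using DERIV_isCont[OF d2[of 0]] unfolding isCont_def by (rule tendsto_within_subset) simp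
  ultimately show "(\<phi>1 \<longlongrightarrow> 0) (at_right 0)" by simp
  assume r: "r > 0"
  have nz: "r *\<^sub>R e \<noteq> 0" using r norm_e by auto
  have nr: "norm (r *\<^sub>R e) = r" using r norm_e by simp
  show "norm (gradient f (r *\<^sub>R e)) = \<bar>\<phi>1 r\<bar>"
    by (subst f_eq) (simp only: norm_gradient_radial[OF nz d1] nr)
  have "laplacian f (r *\<^sub>R e) = partial e (partial e f) (r *\<^sub>R e) + n * \<phi>1 r / r"
    by (subst f_eq) (simp only: laplacian_radial[OF d1 d2 nz] nr, simp add: n)
  \<comment> \<open>For \<open>n = 0\<close> the exponent \<open>n - 1\<close> is truncated, and
    both sides vanish.\<close>
  moreover have "n * r ^ (n - 1) = n * r ^ n / r" using r by (cases n) auto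
  ultimately show "((\<lambda>r. r ^ n * \<phi>1 r) has_real_derivative r ^ n * laplacian f (r *\<^sub>R e)) (at r)"
    by (intro DERIV_cong[OF DERIV_mult[OF DERIV_pow d2]]) (simp add: algebra_simps)
qed

section \<open>The radial system\<close>

text \<open>The profile $v$ of a solution together with $w = u'$ and $z = v'$ in dimension $n + 1$;
  the equations are in divergence form, with weight $r^n$.\<close>

locale radial_solution =
  fixes n :: nat and a b p s :: real and v w z :: "real \<Rightarrow> real"
  assumes a_pos: "a > 0" and b_pos: "b > 0" and p_pos: "p > 0" and s_ge_1: "s \<ge> 1"
    and v_pos: "r \<ge> 0 \<Longrightarrow> v r > 0"
    and v_at_0: "(v \<longlongrightarrow> v 0) (at_right 0)"
    and w_at_0: "(w \<longlongrightarrow> 0) (at_right 0)"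
    and z_at_0: "(z \<longlongrightarrow> 0) (at_right 0)"
    and v_deriv: "r > 0 \<Longrightarrow> (v has_real_derivative z r) (at r)"
    and w_deriv: "r > 0 \<Longrightarrow>
      ((\<lambda>r. r ^ n * w r) has_real_derivative r ^ n * (r powr a * v r powr p)) (at r)"
    and z_deriv: "r > 0 \<Longrightarrow>
      ((\<lambda>r. r ^ n * z r) has_real_derivative r ^ n * (r powr b * \<bar>w r\<bar> powr s)) (at r)"

text \<open>Near 0 the unknowns are controlled only through right limits, so the value at 0 is
  replaced by the limit before the mean value theorem is applied; \<open>g\<close> is this
  modification.\<close>

lemma real_MVT_from_0:
  fixes f :: "real \<Rightarrow> real"
  assumes "(f \<longlongrightarrow> l) (at_right 0)" "R > 0"
    and "\<And>r. 0 < r \<Longrightarrow> (f has_real_derivative f' r) (at r)"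
  obtains \<xi> where "0 < \<xi>" "\<xi> < R" "f R = l + R * f' \<xi>"
proof -
  define g where "g r = (if r = 0 then l else f r)" for r
  have ev: "\<forall>\<^sub>F y in nhds r. g y = f y" if "r > 0" for r
    using that unfolding eventually_nhds by (intro exI[of _ "{0<..}"]) (auto simp: g_def)
  have d: "(g has_real_derivative f' r) (at r)" if "r > 0" for r
    using assms(3)[OF that] DERIV_cong_ev[OF refl ev[OF that] refl] by simp
  have c0: "(g \<longlongrightarrow> g 0) (at_right 0)"
    using assms(1) by (rule Lim_transform_eventually[THEN tendsto_eq_rhs])
      (auto simp: g_def eventually_at_right_field intro!: exI[of _ 1])
  have "continuous_on {0..R} g"
    unfolding continuous_on
  proof
    fix x assume x: "x \<in> {0..R}"
    show "(g \<longlongrightarrow> g x) (at x within {0..R})"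
    proof (cases "x = 0")
      case True
      then show ?thesis using c0 assms(2) by (simp add: at_within_Icc_at_right)
    next
      case False
      then have "isCont g x" using x by (intro DERIV_isCont[OF d]) auto
      then show ?thesis unfolding isCont_def by (rule tendsto_within_subset) simp
    qed
  qed
  moreover have "g differentiable (at x)" if "0 < x" "x < R" for x
    using d[OF that(1)] by (auto simp: real_differentiable_def)
  ultimately obtain l' \<xi> where \<xi>: "0 < \<xi>" "\<xi> < R" "(g has_real_derivative l') (at \<xi>)" "g R - g 0 = (R - 0) * l'"
    using MVT[OF assms(2)] by blast
  from DERIV_unique[OF \<xi>(3) d] \<xi> have "l' = f' \<xi>" by simp
  with \<xi> assms(2) that show ?thesis by (simp add: g_def algebra_simps)
qed

lemma real_MVT_pos:
  fixes f :: "real \<Rightarrow> real"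
  assumes "0 < x" "x < y"
    and "\<And>r. 0 < r \<Longrightarrow> (f has_real_derivative f' r) (at r)"
  obtains \<xi> where "x < \<xi>" "\<xi> < y" "f y = f x + (y - x) * f' \<xi>"
proof -
  have "(f has_real_derivative f' r) (at r)" if "x \<le> r" for r
    using that assms(1) by (intro assms(3)) simp
  from MVT2[OF assms(2) this] obtain \<xi> where "x < \<xi>" "\<xi> < y" "f y - f x = (y - x) * f' \<xi>"
    by blast
  then show ?thesis by (intro that[of \<xi>]) auto
qed

lemma power_powr: "x \<ge> 0 \<Longrightarrow> (x ^ j) powr y = (x powr y) ^ j" for x y :: real
  by (induction j) (auto simp: powr_mult)

section \<open>Positivity, a priori estimates and blow-up at a finite radius\<close>

context radial_solution
begin

lemma weight_at_0:
  assumes "(f \<longlongrightarrow> 0) (at_right 0)"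
  shows "((\<lambda>r. r ^ n * f r) \<longlongrightarrow> 0) (at_right (0::real))"
  by (rule tendsto_eq_intros assms refl | simp)+

lemma w_pos: "r > 0 \<Longrightarrow> w r > 0"
proof -
  assume r: "r > 0"
  obtain \<xi> where \<xi>: "0 < \<xi>" "\<xi> < r" "r ^ n * w r = 0 + r * (\<xi> ^ n * (\<xi> powr a * v \<xi> powr p))"
    using real_MVT_from_0[OF weight_at_0[OF w_at_0] r w_deriv] by blast
  have "v \<xi> > 0" using v_pos \<xi> by simp
  with \<xi> r have "r ^ n * w r > 0" by simp
  then show ?thesis using r by (simp add: zero_less_mult_iff)
qed

lemma z_pos: "r > 0 \<Longrightarrow> z r > 0"
proof -
  assume r: "r > 0"
  obtain \<xi> where \<xi>: "0 < \<xi>" "\<xi> < r" "r ^ n * z r = 0 + r * (\<xi> ^ n * (\<xi> powr b * \<bar>w \<xi>\<bar> powr s))"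
    using real_MVT_from_0[OF weight_at_0[OF z_at_0] r z_deriv] by blast
  have "w \<xi> > 0" using w_pos \<xi> by simp
  with \<xi> r have "r ^ n * z r > 0" by simp
  then show ?thesis using r by (simp add: zero_less_mult_iff)
qed

lemma v_mono: "0 < x \<Longrightarrow> x \<le> y \<Longrightarrow> v x \<le> v y"
proof (cases "x = y")
  assume *: "0 < x" "x \<le> y" "x \<noteq> y"
  then obtain \<xi> where \<xi>: "x < \<xi>" "\<xi> < y" "v y = v x + (y - x) * z \<xi>"
    using real_MVT_pos[OF _ _ v_deriv, of x y] by (metis order_less_le)
  then show ?thesis using z_pos[of \<xi>] * by simp
qed auto

text \<open>As \<open>v\<close> increases, the intermediate point may be replaced by
  \<open>r\<close>, and then the weights cancel. The next two lemmas carry this crude bound through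
  the other two integrations.\<close>

lemma w_le:
  assumes "r > 0"
  shows "w r \<le> r powr (1 + a) * v r powr p"
proof -
  obtain \<xi> where \<xi>: "0 < \<xi>" "\<xi> < r" "r ^ n * w r = 0 + r * (\<xi> ^ n * (\<xi> powr a * v \<xi> powr p))"
    using real_MVT_from_0[OF weight_at_0[OF w_at_0] assms w_deriv] by blast
  have "v \<xi> > 0" "v \<xi> \<le> v r" using v_pos v_mono \<xi> by simp_all
  then have "r * (\<xi> ^ n * (\<xi> powr a * v \<xi> powr p)) \<le> r * (r ^ n * (r powr a * v r powr p))"
    using \<xi> assms a_pos p_pos by (intro mult_mono power_mono powr_mono2) auto
  also have "\<dots> = r ^ n * (r powr (1 + a) * v r powr p)"
    using assms by (simp add: powr_add mult_ac)
  finally have "r ^ n * w r \<le> r ^ n * (r powr (1 + a) * v r powr p)" using \<xi>(3) by linarith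
  then show ?thesis using assms by (simp only: mult_le_cancel_left_pos zero_less_power)
qed

lemma z_le:
  assumes "r > 0"
  shows "z r \<le> r powr (1 + b + s * (1 + a)) * v r powr (p * s)"
proof -
  obtain \<xi> where \<xi>: "0 < \<xi>" "\<xi> < r" "r ^ n * z r = 0 + r * (\<xi> ^ n * (\<xi> powr b * \<bar>w \<xi>\<bar> powr s))"
    using real_MVT_from_0[OF weight_at_0[OF z_at_0] assms z_deriv] by blast
  have v: "v \<xi> > 0" "v \<xi> \<le> v r" "w \<xi> > 0" using v_pos v_mono w_pos \<xi> by simp_all
  have "w \<xi> \<le> \<xi> powr (1 + a) * v \<xi> powr p" using w_le \<xi> by simp
  also have "\<dots> \<le> r powr (1 + a) * v r powr p"
    using \<xi> v assms a_pos p_pos by (intro mult_mono powr_mono2) auto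
  finally have "r * (\<xi> ^ n * (\<xi> powr b * \<bar>w \<xi>\<bar> powr s))
      \<le> r * (r ^ n * (r powr b * (r powr (1 + a) * v r powr p) powr s))"
    using \<xi> v assms b_pos s_ge_1 by (intro mult_mono power_mono powr_mono2) auto
  also have "\<dots> = r ^ n * (r powr (1 + b + s * (1 + a)) * v r powr (p * s))"
    using assms v by (simp add: powr_add powr_mult powr_powr mult_ac distrib_left)
  finally have "r ^ n * z r \<le> r ^ n * (r powr (1 + b + s * (1 + a)) * v r powr (p * s))"
    using \<xi>(3) by linarith
  then show ?thesis using assms by (simp only: mult_le_cancel_left_pos zero_less_power)
qed

lemma v_le:
  assumes "r > 0"
  shows "v r \<le> v 0 + r powr (2 + b + s * (1 + a)) * v r powr (p * s)"
proof -
  obtain \<xi> where \<xi>: "0 < \<xi>" "\<xi> < r" "v r = v 0 + r * z \<xi>"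
    using real_MVT_from_0[OF v_at_0 assms v_deriv] by blast
  have v: "v \<xi> > 0" "v \<xi> \<le> v r" using v_pos[of \<xi>] v_mono[of \<xi> r] \<xi>(1,2) by simp_all
  have "z \<xi> \<le> \<xi> powr (1 + b + s * (1 + a)) * v \<xi> powr (p * s)" using z_le \<xi> by simp
  also have "\<dots> \<le> r powr (1 + b + s * (1 + a)) * v r powr (p * s)"
    using \<xi> v assms a_pos b_pos p_pos s_ge_1 by (intro mult_mono powr_mono2) auto
  finally have "r * z \<xi> \<le> r * (r powr (1 + b + s * (1 + a)) * v r powr (p * s))"
    using assms by simp
  also have "\<dots> = r powr (2 + b + s * (1 + a)) * v r powr (p * s)"
    using assms powr_add[of r 1 "1 + b + s * (1 + a)"] by (simp add: add.assoc mult.assoc)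
  finally show ?thesis using \<xi> by simp
qed

text \<open>For \<open>h \<le> r\<close> the weight grows by a factor of at most
  \<open>4 ^ n\<close> over \<open>[r, r + 3 * h]\<close>. This is lost once for \<open>w\<close>,
  where it is then raised to the power \<open>s\<close>, and once for \<open>z\<close>.\<close>

definition step_const :: real where
  "step_const = ((1 / 4) ^ n) powr (1 + s)"

lemma step_const_pos: "step_const > 0"
  by (simp add: step_const_def)

text \<open>Integrating each of the three equations over one third of $[r, r + 3h]$.\<close>

lemma v_step:
  assumes r: "0 < r" and h: "0 < h" "h \<le> r"
  shows "v (r + 3 * h) \<ge> v r + step_const * h powr (2 + s) * r powr (b + a * s) * v r powr (p * s)"
proof -
  define \<gamma> :: real where "\<gamma> = (1 / 4) ^ n"
  have \<gamma>: "\<gamma> > 0" by (simp add: \<gamma>_def)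
  have vr: "v r > 0" using v_pos r by simp
  have weight: "\<gamma> * t ^ n \<le> r ^ n" if "0 < t" "t \<le> r + 3 * h" for t
    unfolding \<gamma>_def power_mult_distrib[symmetric] using that h r by (intro power_mono) auto
  define W where "W = h * \<gamma> * r powr a * v r powr p"
  have W: "W > 0" using \<gamma> h r vr by (simp add: W_def)
  have w: "w t \<ge> W" if t: "r + h < t" "t \<le> r + 3 * h" for t
  proof -
    obtain \<xi> where \<xi>: "r < \<xi>" "\<xi> < t" "t ^ n * w t = r ^ n * w r + (t - r) * (\<xi> ^ n * (\<xi> powr a * v \<xi> powr p))"
      using real_MVT_pos[OF r _ w_deriv, of t] t h by auto
    \<comment> \<open>The interval from \<open>r\<close> to \<open>t\<close> is longer than
      \<open>h\<close>, and on it the source is at least its value at \<open>r\<close>.\<close>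
    have "h * (r ^ n * (r powr a * v r powr p)) \<le> (t - r) * (\<xi> ^ n * (\<xi> powr a * v \<xi> powr p))"
      using \<xi> r t h v_mono[of r \<xi>] vr a_pos p_pos by (intro mult_mono power_mono powr_mono2) auto
    moreover have "r ^ n * w r > 0" using w_pos r by simp
    moreover have "h * (\<gamma> * t ^ n * (r powr a * v r powr p)) \<le> h * (r ^ n * (r powr a * v r powr p))"
      using weight[of t] r t h by (intro mult_left_mono mult_right_mono) auto
    ultimately have "t ^ n * W \<le> t ^ n * w t" using \<xi> by (simp add: W_def mult_ac)
    then show ?thesis using r t h by simp
  qed
  define Z where "Z = h * \<gamma> * r powr b * W powr s"
  have z: "z t \<ge> Z" if t: "r + 2 * h < t" "t \<le> r + 3 * h" for t
  proof -
    obtain \<xi> where \<xi>: "r + h < \<xi>" "\<xi> < t"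
      "t ^ n * z t = (r + h) ^ n * z (r + h) + (t - (r + h)) * (\<xi> ^ n * (\<xi> powr b * \<bar>w \<xi>\<bar> powr s))"
      using real_MVT_pos[OF _ _ z_deriv, of "r + h" t] t h r by auto
    have "h * (r ^ n * (r powr b * W powr s)) \<le> (t - (r + h)) * (\<xi> ^ n * (\<xi> powr b * \<bar>w \<xi>\<bar> powr s))"
      using \<xi> r t h w[of \<xi>] W b_pos s_ge_1 by (intro mult_mono power_mono powr_mono2) auto
    moreover have "(r + h) ^ n * z (r + h) > 0" using z_pos r h by simp
    moreover have "h * (\<gamma> * t ^ n * (r powr b * W powr s)) \<le> h * (r ^ n * (r powr b * W powr s))"
      using weight[of t] r t h by (intro mult_left_mono mult_right_mono) auto
    ultimately have "t ^ n * Z \<le> t ^ n * z t" using \<xi> by (simp add: Z_def mult_ac)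
    then show ?thesis using r t h by simp
  qed
  obtain \<xi> where \<xi>: "r + 2 * h < \<xi>" "\<xi> < r + 3 * h"
      "v (r + 3 * h) = v (r + 2 * h) + (r + 3 * h - (r + 2 * h)) * z \<xi>"
    using real_MVT_pos[OF _ _ v_deriv, of "r + 2 * h" "r + 3 * h"] h r by auto
  have "h * Z \<le> h * z \<xi>" using z[of \<xi>] \<xi> h by simp
  moreover have "v r \<le> v (r + 2 * h)" using v_mono r h by simp
  moreover have "h * Z = step_const * h powr (2 + s) * r powr (b + a * s) * v r powr (p * s)"
  proof -
    have W_powr: "W powr s = h powr s * \<gamma> powr s * r powr (a * s) * v r powr (p * s)"
      using h \<gamma> r vr by (simp add: W_def powr_mult powr_powr)
    have sc: "step_const = \<gamma> * \<gamma> powr s"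
      unfolding step_const_def \<gamma>_def[symmetric] using \<gamma> by (simp add: powr_add)
    have "h powr (2 + s) = h * (h * h powr s)"
      using h by (simp add: powr_add power2_eq_square)
    then show ?thesis by (simp add: Z_def W_powr sc powr_add[of r b] mult_ac)
  qed
  ultimately show ?thesis using \<xi> by simp
qed

lemma global_imp_le_1: "p * s \<le> 1"
proof (rule ccontr)
  assume "\<not> p * s \<le> 1"
  then have q: "p * s > 1" by simp
  define \<kappa> where "\<kappa> = step_const"
  have \<kappa>: "\<kappa> > 0" using step_const_pos by (simp add: \<kappa>_def)
  \<comment> \<open>Chosen so that a gain \<open>\<mu> ^ j\<close> in \<open>v\<close>, raised to
    the power \<open>p * s - 1\<close>, cancels the factor \<open>h powr (2 + s)\<close> for
    \<open>h = (1/2) ^ j\<close>.\<close>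
  define \<mu> where "\<mu> = 2 powr ((2 + s) / (p * s - 1))"
  have \<mu>1: "\<mu> > 1" using q s_ge_1 by (simp add: \<mu>_def)
  have \<mu>: "\<mu> powr (p * s - 1) = 2 powr (2 + s)" using q by (simp add: \<mu>_def powr_powr)
  have step: "v (r + 3 * h) \<ge> v r + \<kappa> * h powr (2 + s) * v r powr (p * s)"
    if "1 \<le> r" "0 < h" "h \<le> 1" for r h
  proof -
    have "1 \<le> r powr (b + a * s)" using that a_pos b_pos s_ge_1 by (intro ge_one_powr_ge_zero) auto
    then have "\<kappa> * h powr (2 + s) * 1 * v r powr (p * s) \<le> \<kappa> * h powr (2 + s) * r powr (b + a * s) * v r powr (p * s)"
      using \<kappa> by (intro mult_right_mono mult_left_mono) auto
    then show ?thesis using v_step[of r h] that by (simp add: \<kappa>_def)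
  qed
  \<comment> \<open>Unit steps give linear growth, which brings \<open>v\<close> above any
    threshold.\<close>
  have lin: "v (1 + 3 * real k) \<ge> real k * (\<kappa> * v 1 powr (p * s))" for k
  proof (induction k)
    case 0 then show ?case using v_pos[of 1] by simp
  next
    case (Suc k)
    have "v 1 powr (p * s) \<le> v (1 + 3 * real k) powr (p * s)"
      using v_mono[of 1 "1 + 3 * real k"] v_pos[of 1] q by (intro powr_mono2) auto
    then have "\<kappa> * v 1 powr (p * s) \<le> \<kappa> * v (1 + 3 * real k) powr (p * s)" using \<kappa> by simp
    moreover have "v (1 + 3 * real k + 3 * 1) \<ge> v (1 + 3 * real k) + \<kappa> * 1 powr (2 + s) * v (1 + 3 * real k) powr (p * s)"
      by (rule step) auto
    ultimately show ?case using Suc by (simp add: algebra_simps)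
  qed
  \<comment> \<open>Above this threshold a unit step multiplies \<open>v\<close> by at least
    \<open>\<mu>\<close>.\<close>
  define M where "M = (\<mu> / \<kappa>) powr (1 / (p * s - 1)) + 1"
  have M: "M > 0" "\<kappa> * M powr (p * s - 1) \<ge> \<mu>"
  proof -
    show "M > 0" by (simp add: M_def add_nonneg_pos)
    have "\<mu> = \<kappa> * ((\<mu> / \<kappa>) powr (1 / (p * s - 1))) powr (p * s - 1)"
      using q \<kappa> \<mu>1 by (simp add: powr_powr)
    also have "\<dots> \<le> \<kappa> * M powr (p * s - 1)"
      using q \<kappa> by (intro mult_left_mono powr_mono2) (auto simp: M_def)
    finally show "\<kappa> * M powr (p * s - 1) \<ge> \<mu>" .
  qed
  obtain k :: nat where k: "real k > M / (\<kappa> * v 1 powr (p * s))" using reals_Archimedean2 by blast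
  define r0 where "r0 = 1 + 3 * real k"
  have "\<kappa> * v 1 powr (p * s) > 0" using \<kappa> v_pos[of 1] by simp
  then have r0: "v r0 \<ge> M" "r0 \<ge> 1" using k lin[of k] by (simp_all add: r0_def field_simps)
  \<comment> \<open>The steps \<open>3 * (1/2) ^ j\<close> add up to 6, so all these radii stay
    below \<open>r0 + 6\<close>.\<close>
  define \<rho> where "\<rho> j = r0 + 6 * (1 - (1/2) ^ j)" for j :: nat
  have \<rho>: "\<rho> (Suc j) = \<rho> j + 3 * (1/2) ^ j" "r0 \<le> \<rho> j" "\<rho> j \<le> r0 + 6" for j
    by (auto simp: \<rho>_def power_le_one)
  have blow: "v (\<rho> j) \<ge> M * \<mu> ^ j" for j
  proof (induction j)
    case 0 then show ?case using r0 by (simp add: \<rho>_def)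
  next
    case (Suc j)
    have V: "0 < v (\<rho> j)" using \<rho>[of j] r0 by (intro v_pos) auto
    have "M powr (p * s - 1) * (2 powr (2 + s)) ^ j = (M * \<mu> ^ j) powr (p * s - 1)"
      using M \<mu>1 by (simp add: powr_mult power_powr \<mu>)
    also have "\<dots> \<le> v (\<rho> j) powr (p * s - 1)" using Suc q M \<mu>1 by (intro powr_mono2) auto
    finally have *: "\<kappa> * (M powr (p * s - 1) * (2 powr (2 + s)) ^ j) \<le> \<kappa> * v (\<rho> j) powr (p * s - 1)"
      by (intro mult_left_mono) (use \<kappa> in auto)
    have inv: "((1/2) ^ j) powr (2 + s) * (2 powr (2 + s)) ^ j = (1::real)"
      by (subst power_powr) (simp_all add: powr_divide flip: power_mult_distrib)
    have "\<mu> \<le> \<kappa> * M powr (p * s - 1)" by fact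
    also have "\<dots> = ((1/2) ^ j) powr (2 + s) * (\<kappa> * (M powr (p * s - 1) * (2 powr (2 + s)) ^ j))"
      using inv by (simp add: mult_ac)
    also have "\<dots> \<le> ((1/2) ^ j) powr (2 + s) * (\<kappa> * v (\<rho> j) powr (p * s - 1))"
      by (rule mult_left_mono[OF *]) simp
    finally have "\<mu> * v (\<rho> j) \<le> ((1/2) ^ j) powr (2 + s) * (\<kappa> * v (\<rho> j) powr (p * s - 1)) * v (\<rho> j)"
      by (rule mult_right_mono) (use V in simp)
    also have "\<dots> = \<kappa> * ((1/2) ^ j) powr (2 + s) * v (\<rho> j) powr (p * s)"
      using V by (simp add: powr_diff)
    also have "\<dots> \<le> v (\<rho> (Suc j))"
      using step[of "\<rho> j" "(1/2)^j"] \<rho>[of j] r0 V by (simp add: power_le_one)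
    finally have "\<mu> * v (\<rho> j) \<le> v (\<rho> (Suc j))" .
    moreover have "M * \<mu> ^ Suc j \<le> \<mu> * v (\<rho> j)" using Suc \<mu>1 by simp
    ultimately show ?case by linarith
  qed
  obtain j where j: "v (r0 + 6) / M < \<mu> ^ j" using real_arch_pow[OF \<mu>1] by blast
  have "v (\<rho> j) \<le> v (r0 + 6)" using \<rho>[of j] r0 by (intro v_mono) auto
  with blow[of j] j M show False by (simp add: field_simps)
qed

end

section \<open>Asymptotics\<close>

text \<open>An eventual lower bound if $\theta < 1$, an eventual upper bound if $\theta > 1$; this
  treats the two halves of the asymptotic analysis simultaneously.\<close>

definition one_sided :: "real \<Rightarrow> (real \<Rightarrow> real) \<Rightarrow> (real \<Rightarrow> real) \<Rightarrow> bool" where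
  "one_sided \<theta> f g \<longleftrightarrow>
     (\<forall>\<^sub>F r in at_top. (\<theta> < 1 \<longrightarrow> g r \<le> f r) \<and> (1 < \<theta> \<longrightarrow> f r \<le> g r))"

section \<open>Rules for one-sided asymptotic bounds\<close>

lemma one_sided_powr:
  assumes "one_sided \<theta> f g" "\<forall>\<^sub>F r in at_top. f r \<ge> 0" "\<forall>\<^sub>F r in at_top. g r \<ge> 0" "e \<ge> 0"
  shows "one_sided \<theta> (\<lambda>r. f r powr e) (\<lambda>r. g r powr e)"
  using assms(1-3) unfolding one_sided_def
  by eventually_elim (use assms(4) in \<open>auto intro: powr_mono2\<close>)

lemma one_sided_mult:
  assumes "one_sided \<theta> f g" "\<forall>\<^sub>F r in at_top. h r \<ge> 0"
  shows "one_sided \<theta> (\<lambda>r. h r * f r) (\<lambda>r. h r * g r)"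
  using assms unfolding one_sided_def
  by eventually_elim (auto intro: mult_left_mono)

lemma one_sided_cong:
  assumes "one_sided \<theta> f g" "\<forall>\<^sub>F r in at_top. f r = f' r" "\<forall>\<^sub>F r in at_top. g r = g' r"
  shows "one_sided \<theta> f' g'"
  using assms unfolding one_sided_def by eventually_elim auto

lemma one_sided_weaken:
  assumes "one_sided \<theta> f (\<lambda>r. k * r powr \<beta>)" "\<theta> < 1 \<longrightarrow> k' \<le> k" "1 < \<theta> \<longrightarrow> k \<le> k'"
  shows "one_sided \<theta> f (\<lambda>r. k' * r powr \<beta>)"
  using assms(1) unfolding one_sided_def
proof eventually_elim
  case (elim r)
  then show ?case
    using assms(2,3) mult_right_mono[of k' k "r powr \<beta>"] mult_right_mono[of k k' "r powr \<beta>"] by auto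
qed

text \<open>\<open>G\<close> is eventually nondecreasing, hence eventually bounded below by a
  constant; the strict inequality between \<open>k'\<close> and \<open>k / \<beta>\<close> leaves a
  multiple of \<open>r powr \<beta>\<close> that absorbs this constant.\<close>

lemma eventually_ge_powr_integrate:
  fixes F f :: "real \<Rightarrow> real"
  assumes deriv: "\<And>r. r > 0 \<Longrightarrow> (F has_real_derivative f r) (at r)"
    and \<beta>: "\<beta> > 0" and ge: "\<forall>\<^sub>F r in at_top. k * r powr (\<beta> - 1) \<le> f r"
    and k': "k' < k / \<beta>"
  shows "\<forall>\<^sub>F r in at_top. k' * r powr \<beta> \<le> F r"
proof -
  obtain R0 where R0: "\<And>r. r \<ge> R0 \<Longrightarrow> k * r powr (\<beta> - 1) \<le> f r"
    using ge by (auto simp: eventually_at_top_linorder)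
  define R where "R = max R0 1"
  define G where "G r = F r - k / \<beta> * r powr \<beta>" for r
  have G: "G R \<le> G r" if "R \<le> r" for r
  proof (rule DERIV_nonneg_imp_nondecreasing[OF that])
    fix x assume x: "R \<le> x" "x \<le> r"
    have "(G has_real_derivative f x - k * x powr (\<beta> - 1)) (at x)"
      unfolding G_def using x \<beta> by (auto intro!: derivative_eq_intros deriv simp: R_def)
    then show "\<exists>y. (G has_real_derivative y) (at x) \<and> 0 \<le> y"
      using R0[of x] x by (auto simp: R_def)
  qed
  have "LIM r at_top. (k / \<beta> - k') * r powr \<beta> :> at_top"
    using k' \<beta> by (intro filterlim_tendsto_pos_mult_at_top[OF tendsto_const] real_powr_at_top) auto
  then have "\<forall>\<^sub>F r in at_top. - G R \<le> (k / \<beta> - k') * r powr \<beta>"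
    by (simp add: filterlim_at_top)
  with eventually_ge_at_top[of R] show ?thesis
  proof eventually_elim
    case (elim r)
    then show ?case using G[of r] by (simp add: G_def algebra_simps)
  qed
qed

text \<open>The factor \<open>\<theta>\<close> is the slack that pays for the integration constant.
  Upper bounds are lower bounds for \<open>- F\<close>; at \<open>\<theta> = 1\<close> nothing is
  claimed.\<close>

lemma one_sided_integrate:
  fixes F f :: "real \<Rightarrow> real"
  assumes deriv: "\<And>r. r > 0 \<Longrightarrow> (F has_real_derivative f r) (at r)"
    and \<beta>: "\<beta> > 0" and k: "k > 0" and \<theta>: "\<theta> > 0"
    and dom: "one_sided \<theta> f (\<lambda>r. k * r powr (\<beta> - 1))"
  shows "one_sided \<theta> F (\<lambda>r. \<theta> * k / \<beta> * r powr \<beta>)"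
proof -
  consider "\<theta> < 1" | "\<theta> = 1" | "\<theta> > 1" by linarith
  then show ?thesis
  proof cases
    case 1
    have "\<theta> * k / \<beta> < k / \<beta>" using 1 k \<beta> by (simp add: divide_strict_right_mono)
    from eventually_ge_powr_integrate[OF deriv \<beta> _ this] 1 dom
    show ?thesis by (simp add: one_sided_def)
  next
    case 3
    have D: "((\<lambda>r. - F r) has_real_derivative - f r) (at r)" if "r > 0" for r
      using deriv[OF that] by (rule DERIV_minus)
    have "- (\<theta> * k / \<beta>) < - k / \<beta>" using 3 k \<beta> by (simp add: divide_strict_right_mono)
    from eventually_ge_powr_integrate[OF D \<beta> _ this] 3 dom
    show ?thesis by (simp add: one_sided_def)
  qed (simp add: one_sided_def)
qed

text \<open>L'Hopital's rule in the version where only the denominator has to diverge, so the growth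
  of \<open>F\<close> need not be known beforehand.\<close>

lemma tendsto_powr_integrate:
  fixes F f :: "real \<Rightarrow> real"
  assumes deriv: "\<And>r. r > 0 \<Longrightarrow> (F has_real_derivative f r) (at r)"
    and \<beta>: "\<beta> > 0" and lim: "((\<lambda>r. f r / r powr (\<beta> - 1)) \<longlongrightarrow> k) at_top"
  shows "((\<lambda>r. F r / r powr \<beta>) \<longlongrightarrow> k / \<beta>) at_top"
proof (rule lhospital_at_top_at_top)
  show "LIM r at_top. r powr \<beta> :> at_top" using \<beta> by (rule real_powr_at_top)
  show "\<forall>\<^sub>F r in at_top. \<beta> * r powr (\<beta> - 1) \<noteq> 0"
    using eventually_gt_at_top[of 0] by eventually_elim (use \<beta> in auto)
  show "\<forall>\<^sub>F r in at_top. (F has_real_derivative f r) (at r)"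
    using eventually_gt_at_top[of 0] by eventually_elim (rule deriv)
  show "\<forall>\<^sub>F r in at_top. ((\<lambda>r. r powr \<beta>) has_real_derivative \<beta> * r powr (\<beta> - 1)) (at r)"
    using eventually_gt_at_top[of 0] by eventually_elim (auto intro!: derivative_eq_intros)
  have "((\<lambda>r. f r / r powr (\<beta> - 1) / \<beta>) \<longlongrightarrow> k / \<beta>) at_top"
    using lim \<beta> by (intro tendsto_intros) auto
  then show "((\<lambda>r. f r / (\<beta> * r powr (\<beta> - 1))) \<longlongrightarrow> k / \<beta>) at_top"
    by (simp add: mult.commute)
qed

section \<open>Power growth in the case ps < 1\<close>

locale subcritical_radial_solution = radial_solution +
  assumes subcritical: "p * s < 1"
begin

text \<open>These describe the pure power solution \<open>L * r powr \<sigma>\<close>. The exponent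
  \<open>\<sigma>\<close> balances the powers of \<open>r\<close>; \<open>\<beta>\<close>,
  \<open>\<kappa>\<close> and \<open>\<sigma>\<close> are the exponents of \<open>r ^ n * w\<close>,
  \<open>r ^ n * z\<close> and \<open>v\<close>, hence the divisors in the three integrations, and
  \<open>L\<close> solves \<open>L powr (p * s) = \<sigma> * \<beta> powr s * \<kappa> * L\<close>.
  The theorem writes A, B, K for \<open>\<sigma>\<close>, \<open>\<beta>\<close>,
  \<open>\<kappa>\<close>.\<close>

definition \<sigma> :: real where "\<sigma> = (2 + b + s * (1 + a)) / (1 - p * s)"
definition \<beta> :: real where "\<beta> = n + 1 + a + p * \<sigma>"
definition \<kappa> :: real where "\<kappa> = n + \<sigma> - 1"
definition L :: real where "L = (\<sigma> * \<beta> powr s * \<kappa>) powr (1 / (p * s - 1))"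

lemma \<sigma>_eq: "\<sigma> * (1 - p * s) = 2 + b + s * (1 + a)" "2 + b + s * (1 + a) + p * s * \<sigma> = \<sigma>"
  using subcritical by (simp_all add: \<sigma>_def field_simps)

lemma \<sigma>_gt_1: "\<sigma> > 1"
proof -
  have "1 - p * s < 2 + b + s * (1 + a)"
  proof -
    have "p * s > 0" "s * (1 + a) > 0" using p_pos s_ge_1 a_pos by simp_all
    then show ?thesis using b_pos by linarith
  qed
  then show ?thesis using subcritical by (simp add: \<sigma>_def)
qed

lemma \<beta>_pos: "\<beta> > 0" and \<kappa>_pos: "\<kappa> > 0"
  using \<sigma>_gt_1 a_pos p_pos by (simp_all add: \<beta>_def \<kappa>_def add_pos_pos add_nonneg_pos)

lemma L_pos: "L > 0"
  using \<sigma>_gt_1 \<beta>_pos \<kappa>_pos by (simp add: L_def)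

lemma L_powr: "L powr (p * s) / (\<sigma> * \<beta> powr s * \<kappa>) = L"
proof -
  have "L powr (p * s - 1) = \<sigma> * \<beta> powr s * \<kappa>"
    using subcritical \<sigma>_gt_1 \<beta>_pos \<kappa>_pos by (simp add: L_def powr_powr)
  moreover have "L powr (p * s) = L * L powr (p * s - 1)"
    using L_pos by (simp add: powr_diff)
  ultimately show ?thesis using \<sigma>_gt_1 \<beta>_pos \<kappa>_pos by simp
qed

text \<open>Three integrations cost one factor \<open>\<theta>\<close> each, the first of which is
  afterwards raised to the power \<open>s\<close>: \<open>2 + s\<close> in total. The powers
  \<open>p\<close> and \<open>s\<close> turn \<open>m\<close> into \<open>m powr (p * s)\<close>,
  and \<open>L_powr\<close> reproduces \<open>L\<close>.\<close>

lemma one_sided_step: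
  assumes \<theta>: "\<theta> > 0" and m: "m > 0" and dom: "one_sided \<theta> v (\<lambda>r. L * m * r powr \<sigma>)"
  shows "one_sided \<theta> v (\<lambda>r. L * (\<theta> powr (2 + s) * m powr (p * s)) * r powr \<sigma>)"
proof -
  note ev = eventually_gt_at_top[of "0::real"]
  have [simp]: "r ^ n = r powr n" if "r > 0" for r :: real
    using that by (simp add: powr_realpow)
  define k1 where "k1 = \<theta> * (L * m) powr p / \<beta>"
  have k1: "k1 > 0" using \<theta> L_pos m \<beta>_pos by (simp add: k1_def)
  define k2 where "k2 = \<theta> * k1 powr s / \<kappa>"
  have k2: "k2 > 0" using \<theta> k1 \<kappa>_pos by (simp add: k2_def)
  have "one_sided \<theta> (\<lambda>r. v r powr p) (\<lambda>r. (L * m * r powr \<sigma>) powr p)"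
    using p_pos v_pos L_pos m
    by (intro one_sided_powr[OF dom]) (auto intro!: eventually_mono[OF ev] intro: less_imp_le)
  then have "one_sided \<theta> (\<lambda>r. r ^ n * r powr a * v r powr p) (\<lambda>r. r ^ n * r powr a * (L * m * r powr \<sigma>) powr p)"
    by (rule one_sided_mult) (auto intro!: eventually_mono[OF ev])
  then have "one_sided \<theta> (\<lambda>r. r ^ n * (r powr a * v r powr p)) (\<lambda>r. (L * m) powr p * r powr (\<beta> - 1))"
    by (rule one_sided_cong; use ev in eventually_elim)
      (use L_pos m in \<open>auto simp: powr_mult powr_powr \<beta>_def powr_add mult_ac\<close>)
  from one_sided_integrate[OF w_deriv \<beta>_pos _ \<theta> this] L_pos m
  have "one_sided \<theta> (\<lambda>r. r ^ n * w r) (\<lambda>r. k1 * r powr \<beta>)" by (simp add: k1_def)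
  then have "one_sided \<theta> (\<lambda>r. inverse (r ^ n) * (r ^ n * w r)) (\<lambda>r. inverse (r ^ n) * (k1 * r powr \<beta>))"
    by (rule one_sided_mult) (auto intro!: eventually_mono[OF ev])
  then have "one_sided \<theta> w (\<lambda>r. k1 * r powr (1 + a + p * \<sigma>))"
    by (rule one_sided_cong; use ev in eventually_elim)
      (auto simp: \<beta>_def powr_add field_simps)
  then have "one_sided \<theta> (\<lambda>r. w r powr s) (\<lambda>r. (k1 * r powr (1 + a + p * \<sigma>)) powr s)"
    using w_pos k1 s_ge_1
    by (intro one_sided_powr) (auto intro!: eventually_mono[OF ev] intro: less_imp_le)
  then have "one_sided \<theta> (\<lambda>r. r ^ n * r powr b * w r powr s) (\<lambda>r. r ^ n * r powr b * (k1 * r powr (1 + a + p * \<sigma>)) powr s)"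
    by (rule one_sided_mult) (auto intro!: eventually_mono[OF ev])
  then have "one_sided \<theta> (\<lambda>r. r ^ n * (r powr b * \<bar>w r\<bar> powr s)) (\<lambda>r. k1 powr s * r powr (n + \<sigma> - 1 - 1))"
  proof (rule one_sided_cong; use ev in eventually_elim)
    case (elim r)
    \<comment> \<open>By the scaling relation for \<open>\<sigma>\<close>, the source of
      \<open>z\<close> grows with exponent \<open>\<kappa> - 1\<close>.\<close>
    have e: "real n + \<sigma> - 1 - 1 = real n + (b + (1 + a + p * \<sigma>) * s)"
      using \<sigma>_eq(2) by (simp add: algebra_simps)
    then show "r ^ n * r powr b * (k1 * r powr (1 + a + p * \<sigma>)) powr s = k1 powr s * r powr (n + \<sigma> - 1 - 1)"
      using elim k1 unfolding e
      by (simp add: powr_mult powr_powr powr_add[of r "real n"] powr_add[of r b])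
  next
    case (elim r)
    then show ?case using w_pos[of r] by simp
  qed
  from one_sided_integrate[OF z_deriv _ _ \<theta> this] \<kappa>_pos k1
  have "one_sided \<theta> (\<lambda>r. r ^ n * z r) (\<lambda>r. k2 * r powr \<kappa>)" by (simp add: k2_def \<kappa>_def)
  then have "one_sided \<theta> (\<lambda>r. inverse (r ^ n) * (r ^ n * z r)) (\<lambda>r. inverse (r ^ n) * (k2 * r powr \<kappa>))"
    by (rule one_sided_mult) (auto intro!: eventually_mono[OF ev])
  then have "one_sided \<theta> z (\<lambda>r. k2 * r powr (\<sigma> - 1))"
    by (rule one_sided_cong; use ev in eventually_elim)
      (auto simp: \<kappa>_def powr_add powr_diff field_simps)
  from one_sided_integrate[OF v_deriv _ k2 \<theta> this] \<sigma>_gt_1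
  have "one_sided \<theta> v (\<lambda>r. \<theta> * k2 / \<sigma> * r powr \<sigma>)" by simp
  moreover have "\<theta> * k2 / \<sigma> = L * (\<theta> powr (2 + s) * m powr (p * s))"
  proof -
    have "k1 powr s = \<theta> powr s * (L powr (p * s) * m powr (p * s)) / \<beta> powr s"
      using \<theta> L_pos m \<beta>_pos by (simp add: k1_def powr_mult powr_divide powr_powr)
    then have "\<theta> * k2 / \<sigma> = (\<theta> * \<theta> * \<theta> powr s) * m powr (p * s) * (L powr (p * s) / (\<sigma> * \<beta> powr s * \<kappa>))"
      by (simp add: k2_def mult_ac)
    also have "\<theta> * \<theta> * \<theta> powr s = \<theta> powr (2 + s)"
      using \<theta> by (simp add: powr_add power2_eq_square)
    finally show ?thesis unfolding L_powr by (simp only: mult_ac)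
  qed
  ultimately show ?thesis by simp
qed

text \<open>Unless \<open>v r \<le> 2 * v 0\<close>, the constant in \<open>v_le\<close> is less
  than half of \<open>v r\<close> and is absorbed on the left; division by
  \<open>v r powr (p * s)\<close> leaves the positive power \<open>1 - p * s\<close>.\<close>

lemma v_upper_bound: obtains M where "M > 0" "\<And>r. r \<ge> 1 \<Longrightarrow> v r \<le> M * r powr \<sigma>"
proof
  let ?M = "2 * v 0 + 2 powr (1 / (1 - p * s))"
  show "?M > 0" using v_pos[of 0] by (simp add: add_pos_pos)
  fix r :: real assume r: "r \<ge> 1"
  have vr: "v r > 0" using v_pos r by simp
  have r1: "1 \<le> r powr \<sigma>" using r \<sigma>_gt_1 by (intro ge_one_powr_ge_zero) auto
  show "v r \<le> ?M * r powr \<sigma>"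
  proof (cases "v r \<le> 2 * v 0")
    case True
    also have "2 * v 0 \<le> ?M * 1" by simp
    also have "\<dots> \<le> ?M * r powr \<sigma>" using r1 v_pos[of 0] by (intro mult_left_mono) auto
    finally show ?thesis .
  next
    case False
    have "v r \<le> 2 * r powr (2 + b + s * (1 + a)) * v r powr (p * s)"
      using v_le[of r] r False by simp
    then have "v r powr (1 - p * s) \<le> 2 * r powr (\<sigma> * (1 - p * s))"
      unfolding \<sigma>_eq(1) using vr by (simp add: powr_diff pos_divide_le_eq)
    then have "(v r powr (1 - p * s)) powr (1 / (1 - p * s)) \<le> (2 * r powr (\<sigma> * (1 - p * s))) powr (1 / (1 - p * s))"
      using subcritical by (intro powr_mono2) auto
    then have "v r \<le> 2 powr (1 / (1 - p * s)) * r powr \<sigma>"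
      using vr subcritical r by (simp add: powr_mult powr_powr)
    also have "\<dots> \<le> ?M * r powr \<sigma>" using v_pos[of 0] by (intro mult_right_mono) auto
    finally show ?thesis .
  qed
qed

text \<open>Taking \<open>h = r\<close> in \<open>v_step\<close> carries a bound with constant
  \<open>m\<close> from \<open>r\<close> to \<open>4 * r\<close>, with new constant
  \<open>c * m powr (p * s)\<close>. For small \<open>m\<close> nothing is lost, as
  \<open>p * s < 1\<close>, so the bound spreads from \<open>[1, 4]\<close> to all larger
  radii.\<close>

lemma v_lower_bound: obtains m where "m > 0" "\<And>r. r \<ge> 1 \<Longrightarrow> m * r powr \<sigma> \<le> v r"
proof -
  define c where "c = step_const / 4 powr \<sigma>"
  have c: "c > 0" using step_const_pos by (simp add: c_def)
  \<comment> \<open>The first entry yields the bound on \<open>[1, 4]\<close>, the second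
    \<open>m \<le> c * m powr (p * s)\<close>.\<close>
  define m where "m = min (v 1 / 4 powr \<sigma>) (c powr (1 / (1 - p * s)))"
  have m: "m > 0" using v_pos[of 1] c by (simp add: m_def)
  have "m powr (1 - p * s) \<le> (c powr (1 / (1 - p * s))) powr (1 - p * s)"
    using m subcritical by (intro powr_mono2) (auto simp: m_def)
  also have "\<dots> = c" using c subcritical by (simp add: powr_powr)
  finally have mc: "m \<le> c * m powr (p * s)"
    using m by (simp add: powr_diff pos_divide_le_eq)
  have base: "m * r powr \<sigma> \<le> v r" if "1 \<le> r" "r \<le> 4" for r
  proof -
    have "m * r powr \<sigma> \<le> (v 1 / 4 powr \<sigma>) * 4 powr \<sigma>"
      using that m \<sigma>_gt_1 v_pos[of 1] by (intro mult_mono powr_mono2) (auto simp: m_def)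
    also have "\<dots> = v 1" by simp
    also have "\<dots> \<le> v r" using that by (intro v_mono) auto
    finally show ?thesis .
  qed
  have step: "m * (4 * r) powr \<sigma> \<le> v (4 * r)" if "1 \<le> r" "m * r powr \<sigma> \<le> v r" for r
  proof -
    have vr: "v r > 0" using v_pos that by simp
    have "m * (4 * r) powr \<sigma> \<le> c * m powr (p * s) * (4 * r) powr \<sigma>"
      using mc by (intro mult_right_mono) auto
    also have "\<dots> = step_const * m powr (p * s) * r powr (2 + b + s * (1 + a) + p * s * \<sigma>)"
      unfolding \<sigma>_eq(2) using that by (simp add: c_def powr_mult)
    also have "\<dots> = step_const * r powr (2 + s) * r powr (b + a * s) * (m * r powr \<sigma>) powr (p * s)"
      using that m by (simp add: powr_mult powr_powr powr_add algebra_simps)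
    also have "\<dots> \<le> step_const * r powr (2 + s) * r powr (b + a * s) * v r powr (p * s)"
      using that m step_const_pos p_pos s_ge_1 by (intro mult_left_mono powr_mono2) auto
    also have "\<dots> \<le> v (4 * r)" using v_step[of r r] that vr by simp
    finally show ?thesis .
  qed
  have "\<forall>r. 1 \<le> r \<and> r \<le> 4 ^ Suc j \<longrightarrow> m * r powr \<sigma> \<le> v r" for j
  proof (induction j)
    case (Suc j)
    show ?case
    proof (intro allI impI)
      fix r :: real assume r: "1 \<le> r \<and> r \<le> 4 ^ Suc (Suc j)"
      show "m * r powr \<sigma> \<le> v r"
        using step[of "r / 4"] base[of r] Suc r by (cases "r \<le> 4") auto
    qed
  qed (use base in auto)
  moreover have "\<exists>j. r \<le> 4 ^ Suc j" for r :: real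
  proof -
    obtain j where "r < 4 ^ j" using real_arch_pow[of 4 r] by auto
    moreover have "(4::real) ^ j \<le> 4 ^ Suc j" by simp
    ultimately show ?thesis by (intro exI[of _ j]) linarith
  qed
  ultimately show ?thesis using that[of m] m by blast
qed

text \<open>Iterating \<open>one_sided_step\<close> drives the constant to the fixed point
  $\theta^{(2 + s)/(1 - ps)}$ of $m \mapsto \theta^{2+s} m^{ps}$.\<close>

lemma one_sided_limit:
  assumes \<theta>: "\<theta> > 0" "\<theta> \<noteq> 1"
  shows "one_sided \<theta> v (\<lambda>r. L * \<theta> powr ((2 + s) / (1 - p * s) + 1) * r powr \<sigma>)"
proof -
  define \<gamma> where "\<gamma> = (2 + s) / (1 - p * s)"
  have \<gamma>: "(2 + s) + \<gamma> * (p * s) = \<gamma>"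
    using subcritical by (simp add: \<gamma>_def field_simps)
  have "\<exists>m>0. one_sided \<theta> v (\<lambda>r. m * r powr \<sigma>)"
  proof (cases "\<theta> < 1")
    case True
    obtain m where "m > 0" "\<And>r. r \<ge> 1 \<Longrightarrow> m * r powr \<sigma> \<le> v r" using v_lower_bound by blast
    then show ?thesis using True
      by (intro exI[of _ m]) (auto simp: one_sided_def intro!: eventually_mono[OF eventually_ge_at_top[of 1]])
  next
    case False
    obtain m where "m > 0" "\<And>r. r \<ge> 1 \<Longrightarrow> v r \<le> m * r powr \<sigma>" using v_upper_bound by blast
    then show ?thesis using False
      by (intro exI[of _ m]) (auto simp: one_sided_def intro!: eventually_mono[OF eventually_ge_at_top[of 1]])
  qed
  then obtain m where m: "m > 0" "one_sided \<theta> v (\<lambda>r. m * r powr \<sigma>)" by blast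
  \<comment> \<open>The starting constant relative to the fixed point; each round raises this ratio
    to the power \<open>p * s\<close>.\<close>
  define M where "M = m / (L * \<theta> powr \<gamma>)"
  have M: "M > 0" using m L_pos \<theta> by (simp add: M_def)
  have iter: "one_sided \<theta> v (\<lambda>r. L * (\<theta> powr \<gamma> * M powr ((p * s) ^ j)) * r powr \<sigma>)" for j
  proof (induction j)
    case 0
    have "L * (\<theta> powr \<gamma> * M powr ((p * s) ^ 0)) = m" using m M L_pos \<theta> by (simp add: M_def)
    then show ?case using m by simp
  next
    case (Suc j)
    have "\<theta> powr (2 + s) * (\<theta> powr \<gamma> * M powr ((p * s) ^ j)) powr (p * s)
        = \<theta> powr ((2 + s) + \<gamma> * (p * s)) * M powr ((p * s) ^ Suc j)"
      using \<theta> M by (simp add: powr_mult powr_powr powr_add mult_ac)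
    with one_sided_step[OF \<theta>(1) _ Suc] M \<theta> show ?case by (simp only: \<gamma>) simp
  qed
  have "(\<lambda>j. M powr ((p * s) ^ j)) \<longlonglongrightarrow> M powr 0"
    using subcritical p_pos s_ge_1 M by (intro tendsto_intros LIMSEQ_realpow_zero) auto
  then have lim: "(\<lambda>j. M powr ((p * s) ^ j)) \<longlonglongrightarrow> 1" using M by simp
  \<comment> \<open>Settling for \<open>\<theta>\<close> instead of the limit 1 makes finitely many
    rounds enough; this accounts for the \<open>+ 1\<close> in the exponent.\<close>
  have "\<exists>j. (\<theta> < 1 \<longrightarrow> \<theta> \<le> M powr ((p * s) ^ j)) \<and> (1 < \<theta> \<longrightarrow> M powr ((p * s) ^ j) \<le> \<theta>)"
  proof (cases "\<theta> < 1")
    case True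
    then show ?thesis using eventually_happens[OF order_tendstoD(1)[OF lim True]] by (auto intro: less_imp_le)
  next
    case False
    then have "1 < \<theta>" using \<theta> by simp
    then show ?thesis using eventually_happens[OF order_tendstoD(2)[OF lim \<open>1 < \<theta>\<close>]] by (auto intro: less_imp_le)
  qed
  then obtain j where j: "\<theta> < 1 \<longrightarrow> \<theta> \<le> M powr ((p * s) ^ j)" "1 < \<theta> \<longrightarrow> M powr ((p * s) ^ j) \<le> \<theta>"
    by blast
  have "\<theta> powr (\<gamma> + 1) = \<theta> powr \<gamma> * \<theta>" using \<theta> by (simp add: powr_add)
  then show ?thesis unfolding \<gamma>_def[symmetric]
    by (intro one_sided_weaken[OF iter[of j]]) (use j L_pos in \<open>auto intro: mult_left_mono\<close>)
qed

text \<open>The constant in \<open>one_sided_limit\<close> is continuous in \<open>\<theta>\<close>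
  with value \<open>L\<close> at 1: letting \<open>\<theta>\<close> tend to 1 from below gives the
  lower estimate, from above the upper one.\<close>

lemma v_asymptotics: "((\<lambda>r. v r / r powr \<sigma>) \<longlongrightarrow> L) at_top"
proof (rule order_tendstoI)
  define \<gamma> where "\<gamma> = (2 + s) / (1 - p * s) + 1"
  have lim: "((\<lambda>\<theta>. L * \<theta> powr \<gamma>) \<longlongrightarrow> L) (at 1 within S)" for S
    by (rule tendsto_eq_intros refl | simp)+
  fix y
  {
    assume "y < L"
    then have "\<forall>\<^sub>F \<theta> in at_left 1. y < L * \<theta> powr \<gamma>" by (rule order_tendstoD(1)[OF lim])
    moreover have "\<forall>\<^sub>F \<theta> in at_left (1::real). 0 < \<theta> \<and> \<theta> < 1"
      using eventually_at_left_real[of 0 1] by simp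
    ultimately obtain \<theta> where \<theta>: "y < L * \<theta> powr \<gamma>" "0 < \<theta>" "\<theta> < 1"
      using eventually_happens[OF eventually_conj] trivial_limit_at_left_real by blast
    have "\<forall>\<^sub>F r in at_top. L * \<theta> powr \<gamma> * r powr \<sigma> \<le> v r"
      using one_sided_limit[of \<theta>] \<theta> by (simp add: one_sided_def \<gamma>_def)
    with eventually_gt_at_top[of 0] show "\<forall>\<^sub>F r in at_top. y < v r / r powr \<sigma>"
    proof eventually_elim
      case (elim r)
      then have "L * \<theta> powr \<gamma> \<le> v r / r powr \<sigma>" by (simp add: pos_le_divide_eq)
      with \<theta> show ?case by linarith
    qed
  }
  {
    assume "L < y"
    then have "\<forall>\<^sub>F \<theta> in at_right 1. L * \<theta> powr \<gamma> < y" by (rule order_tendstoD(2)[OF lim])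
    moreover have "\<forall>\<^sub>F \<theta> in at_right (1::real). 1 < \<theta>" by (rule eventually_at_right_less)
    ultimately obtain \<theta> where \<theta>: "L * \<theta> powr \<gamma> < y" "1 < \<theta>"
      using eventually_happens[OF eventually_conj] trivial_limit_at_right_real by blast
    have "\<forall>\<^sub>F r in at_top. v r \<le> L * \<theta> powr \<gamma> * r powr \<sigma>"
      using one_sided_limit[of \<theta>] \<theta> by (simp add: one_sided_def \<gamma>_def)
    with eventually_gt_at_top[of 0] show "\<forall>\<^sub>F r in at_top. v r / r powr \<sigma> < y"
    proof eventually_elim
      case (elim r)
      then have "v r / r powr \<sigma> \<le> L * \<theta> powr \<gamma>" by (simp add: pos_divide_le_eq)
      with \<theta> show ?case by linarith
    qed
  }
qed

text \<open>With the leading term of \<open>v\<close> known, two exact integrations suffice, one for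
  \<open>r ^ n * w\<close> and one for \<open>u\<close>; their divisors appear in the limit.\<close>

lemma u_asymptotics:
  assumes u: "\<And>r. r > 0 \<Longrightarrow> (u has_real_derivative w r) (at r)"
  shows "((\<lambda>r. u r / r powr (2 + a + p * \<sigma>)) \<longlongrightarrow> L powr p / \<beta> / (2 + a + p * \<sigma>)) at_top"
proof -
  note ev = eventually_gt_at_top[of "0::real"]
  have "((\<lambda>r. (v r / r powr \<sigma>) powr p) \<longlongrightarrow> L powr p) at_top"
    using v_asymptotics L_pos by (intro tendsto_intros) auto
  then have "((\<lambda>r. r ^ n * (r powr a * v r powr p) / r powr (\<beta> - 1)) \<longlongrightarrow> L powr p) at_top"
  proof (rule Lim_transform_eventually, use ev in eventually_elim)
    case (elim r)
    then show ?case using v_pos[of r]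
      by (simp add: powr_divide powr_powr \<beta>_def powr_add powr_realpow mult_ac)
  qed
  from tendsto_powr_integrate[OF w_deriv \<beta>_pos this]
  have "((\<lambda>r. r ^ n * w r / r powr \<beta>) \<longlongrightarrow> L powr p / \<beta>) at_top" by simp
  then have "((\<lambda>r. w r / r powr (2 + a + p * \<sigma> - 1)) \<longlongrightarrow> L powr p / \<beta>) at_top"
  proof (rule Lim_transform_eventually, use ev in eventually_elim)
    case (elim r)
    have "\<beta> = n + (2 + a + p * \<sigma> - 1)" by (simp add: \<beta>_def)
    then have "r powr \<beta> = r ^ n * r powr (2 + a + p * \<sigma> - 1)" using elim by (simp only: powr_add powr_realpow)
    then show ?case using elim by simp
  qed
  then show ?thesis
    by (rule tendsto_powr_integrate[rotated 2]) (use u p_pos a_pos \<sigma>_gt_1 in \<open>auto intro!: add_pos_pos\<close>)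
qed

end

section \<open>Existence\<close>

text \<open>Solution operator of $(r^n w)' = r^n f$, $w(0) = 0$, namely
  $w(r) = r^{-n} \int_0^r t^n f(t) dt$ after the substitution $t = r\tau$. In this form it is
  defined at $r = 0$ and visibly preserves monotonicity.\<close>

definition radial_integral :: "nat \<Rightarrow> (real \<Rightarrow> real) \<Rightarrow> real \<Rightarrow> real" where
  "radial_integral n f r = r * integral {0..1} (\<lambda>\<tau>. \<tau> ^ n * f (r * \<tau>))"

text \<open>Monotone functions are integrable on compact intervals without being continuous, and
  bounded suprema of them are monotone; this is the class in which the fixed point is
  sought.\<close>

definition nonneg_mono :: "(real \<Rightarrow> real) \<Rightarrow> bool" where
  "nonneg_mono f \<longleftrightarrow> mono_on {0..} f \<and> (\<forall>r\<ge>0. 0 \<le> f r)"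

lemma nonneg_monoD:
  assumes "nonneg_mono f"
  shows "0 \<le> r \<Longrightarrow> 0 \<le> f r" "0 \<le> x \<Longrightarrow> x \<le> y \<Longrightarrow> f x \<le> f y"
  using assms by (auto simp: nonneg_mono_def mono_on_def)

lemma nonneg_monoI:
  assumes "\<And>r. 0 \<le> r \<Longrightarrow> 0 \<le> f r" "\<And>x y. 0 \<le> x \<Longrightarrow> x \<le> y \<Longrightarrow> f x \<le> f y"
  shows "nonneg_mono f"
  using assms by (auto simp: nonneg_mono_def mono_on_def)

section \<open>Order and regularity properties of the radial integral\<close>

lemma nonneg_mono_weight:
  assumes "nonneg_mono f" "a \<ge> 0" "p \<ge> 0"
  shows "nonneg_mono (\<lambda>r. r powr a * f r powr p)"
  using assms(2,3) nonneg_monoD[OF assms(1)]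
  by (auto intro!: nonneg_monoI mult_mono powr_mono2)

lemma radial_integrand_integrable:
  assumes "nonneg_mono f" "r \<ge> 0"
  shows "(\<lambda>\<tau>. \<tau> ^ n * f (r * \<tau>)) integrable_on {0..1}"
  using assms(2)
  by (intro integrable_on_mono_on mono_onI mult_mono power_mono)
    (auto intro!: nonneg_monoD[OF assms(1)] mult_left_mono)

lemma radial_integral_nonneg:
  assumes "nonneg_mono f" "r \<ge> 0"
  shows "0 \<le> radial_integral n f r"
  unfolding radial_integral_def using nonneg_monoD[OF assms(1)] assms(2)
  by (intro mult_nonneg_nonneg integral_nonneg radial_integrand_integrable assms) auto

lemma radial_integral_mono:
  assumes "nonneg_mono f" "nonneg_mono g" "\<And>t. 0 \<le> t \<Longrightarrow> t \<le> r \<Longrightarrow> f t \<le> g t" "r \<ge> 0"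
  shows "radial_integral n f r \<le> radial_integral n g r"
  unfolding radial_integral_def using assms(3,4)
  by (intro mult_left_mono integral_le radial_integrand_integrable assms) (auto intro: mult_left_le)

lemma nonneg_mono_radial_integral:
  assumes "nonneg_mono f"
  shows "nonneg_mono (radial_integral n f)"
proof (rule nonneg_monoI)
  fix x y :: real assume xy: "0 \<le> x" "x \<le> y"
  have "integral {0..1} (\<lambda>\<tau>. \<tau> ^ n * f (x * \<tau>)) \<le> integral {0..1} (\<lambda>\<tau>. \<tau> ^ n * f (y * \<tau>))"
    using xy
    by (intro integral_le radial_integrand_integrable assms)
      (auto intro!: mult_left_mono mult_right_mono nonneg_monoD(2)[OF assms])
  moreover have "0 \<le> integral {0..1} (\<lambda>\<tau>. \<tau> ^ n * f (x * \<tau>))"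
    using xy nonneg_monoD[OF assms] by (intro integral_nonneg radial_integrand_integrable assms) auto
  ultimately show "radial_integral n f x \<le> radial_integral n f y"
    unfolding radial_integral_def using xy by (intro mult_mono) auto
qed (rule radial_integral_nonneg[OF assms])

lemma radial_integral_le:
  assumes "nonneg_mono f" "r \<ge> 0"
  shows "radial_integral n f r \<le> r * f r"
proof -
  have "integral {0..1} (\<lambda>\<tau>. \<tau> ^ n * f (r * \<tau>)) \<le> integral {0..1::real} (\<lambda>\<tau>. f r)"
  proof (intro integral_le radial_integrand_integrable assms)
    fix \<tau> :: real assume \<tau>: "\<tau> \<in> {0..1}"
    have "\<tau> ^ n * f (r * \<tau>) \<le> 1 * f r"
      using \<tau> assms(2)
      by (intro mult_mono power_le_one) (auto intro!: nonneg_monoD[OF assms(1)] mult_left_le)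
    then show "\<tau> ^ n * f (r * \<tau>) \<le> f r" by simp
  qed auto
  then show ?thesis
    unfolding radial_integral_def using assms(2) by (intro mult_left_mono) auto
qed

lemma integrable_weight:
  fixes f :: "real \<Rightarrow> real"
  assumes "nonneg_mono f"
  shows "(\<lambda>t. t ^ n * f t) integrable_on {0..R}"
  using nonneg_monoD[OF assms] by (intro integrable_on_mono_on mono_onI mult_mono power_mono) auto

lemma radial_integral_eq:
  assumes "nonneg_mono f" "r \<ge> 0"
  shows "r ^ n * radial_integral n f r = integral {0..r} (\<lambda>t. t ^ n * f t)"
proof (cases "r = 0")
  case False
  then have r: "r > 0" using assms by simp
  have "((\<lambda>t. t ^ n * f t) has_integral integral {0..r} (\<lambda>t. t ^ n * f t)) {0..r}"
    by (rule integrable_integral[OF integrable_weight[OF assms(1)]])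
  from has_integral_stretch_real[OF this False]
  have "((\<lambda>\<tau>. (r * \<tau>) ^ n * f (r * \<tau>)) has_integral integral {0..r} (\<lambda>t. t ^ n * f t) / r) {0..1}"
    using r by (simp add: image_divide_atLeastAtMost)
  then have "integral {0..1} (\<lambda>\<tau>. r ^ n * (\<tau> ^ n * f (r * \<tau>))) = integral {0..r} (\<lambda>t. t ^ n * f t) / r"
    unfolding power_mult_distrib mult.assoc by (rule integral_unique)
  then have "r ^ n * integral {0..1} (\<lambda>\<tau>. \<tau> ^ n * f (r * \<tau>)) * r = integral {0..r} (\<lambda>t. t ^ n * f t)"
    using r by simp
  then show ?thesis by (simp only: radial_integral_def mult_ac)
qed (simp add: radial_integral_def)

text \<open>Indefinite integrals are continuous even if the integrand is merely monotone. This is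
  how the fixed point, obtained as a supremum, turns out to be continuous.\<close>

lemma continuous_on_radial_integral:
  assumes "nonneg_mono f"
  shows "continuous_on {0<..} (radial_integral n f)"
proof -
  have "isCont (radial_integral n f) r" if "r > 0" for r
  proof -
    have "continuous_on {0..2 * r} (\<lambda>x. integral {0..x} (\<lambda>t. t ^ n * f t))"
      by (rule indefinite_integral_continuous_1[OF integrable_weight[OF assms]])
    then have "continuous_on {0<..<2 * r} (\<lambda>x. integral {0..x} (\<lambda>t. t ^ n * f t))"
      by (rule continuous_on_subset) auto
    then have "continuous_on {0<..<2 * r} (\<lambda>x. integral {0..x} (\<lambda>t. t ^ n * f t) / x ^ n)"
      by (intro continuous_intros) auto
    moreover have "integral {0..x} (\<lambda>t. t ^ n * f t) / x ^ n = radial_integral n f x" if "x > 0" for x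
      using that by (simp flip: radial_integral_eq[OF assms])
    ultimately have "continuous_on {0<..<2 * r} (radial_integral n f)"
      by (rule continuous_on_cong[THEN iffD1, OF refl, rotated]) auto
    then show ?thesis using that by (simp add: continuous_on_eq_continuous_at)
  qed
  then show ?thesis by (simp add: continuous_at_imp_continuous_on)
qed

lemma radial_integral_weighted_deriv:
  assumes f: "nonneg_mono f" and cont: "isCont f r" and r: "r > 0"
  shows "((\<lambda>r. r ^ n * radial_integral n f r) has_real_derivative r ^ n * f r) (at r)"
proof -
  have "isCont (\<lambda>t. t ^ n * f t) r" by (intro continuous_intros cont)
  then have "((\<lambda>x. integral {0..x} (\<lambda>t. t ^ n * f t)) has_vector_derivative r ^ n * f r)
      (at r within ({0..2 * r} - {}))"
    using r by (intro integral_has_vector_derivative_continuous_at integrable_weight f)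
      (simp_all add: continuous_at_imp_continuous_at_within)
  moreover have "at r within {0..2 * r} = at r"
    using r by (simp add: at_within_Icc_at)
  ultimately have "((\<lambda>x. integral {0..x} (\<lambda>t. t ^ n * f t)) has_real_derivative r ^ n * f r) (at r)"
    by (simp add: has_real_derivative_iff_has_vector_derivative)
  then show ?thesis
    by (rule has_field_derivative_transform_within_open[where S = "{0<..}"])
      (use r in \<open>auto simp: radial_integral_eq[OF f]\<close>)
qed

lemma radial_integral_deriv:
  assumes f: "nonneg_mono f" and cont: "isCont f r" and r: "r > 0"
  shows "(radial_integral n f has_real_derivative f r - n * radial_integral n f r / r) (at r)"
proof (rule has_field_derivative_transform_within_open[where S = "{0<..}"])
  have "n * r ^ (n - 1) * r = n * r ^ n" by (cases n) auto
  then show "((\<lambda>r. r ^ n * radial_integral n f r / r ^ n) has_real_derivative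
      f r - n * radial_integral n f r / r) (at r)"
    using r
    by (intro DERIV_cong[OF DERIV_divide[OF radial_integral_weighted_deriv[OF f cont r] DERIV_pow]])
      (auto simp: divide_simps power2_eq_square algebra_simps)
qed (use r in auto)

text \<open>\<open>radial_integral 0\<close> is the plain integral from 0, so \<open>F\<close> has
  radial derivative \<open>radial_integral n f\<close>. The bounds
  \<open>0 \<le> radial_integral n f r \<le> r * f r\<close> and the vanishing of \<open>f\<close>
  at 0 give the limits that \<open>radial_extension\<close> asks for.\<close>

lemma radial_Poisson:
  fixes f :: "real \<Rightarrow> real"
  assumes f: "nonneg_mono f" and cont: "continuous_on {0<..} f"
    and f0: "f 0 = 0" and lim: "(f \<longlongrightarrow> 0) (at_right 0)" and n: "DIM('a::euclidean_space) = Suc n"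
  defines "F \<equiv> (\<lambda>x::'a::euclidean_space. 1 + radial_integral 0 (radial_integral n f) (norm x))"
  shows "C2_function F" "laplacian F x = f (norm x)" "norm (gradient F x) = radial_integral n f (norm x)"
proof -
  let ?w = "radial_integral n f"
  define \<phi> where "\<phi> r = 1 + radial_integral 0 ?w r" for r
  have w: "nonneg_mono ?w" using f by (rule nonneg_mono_radial_integral)
  have fc: "isCont f r" if "r > 0" for r
    using cont that by (simp add: continuous_on_eq_continuous_at)
  have wc: "isCont ?w r" if "r > 0" for r
    using continuous_on_radial_integral[OF f] that by (simp add: continuous_on_eq_continuous_at)
  have d1: "(\<phi> has_real_derivative ?w r) (at r)" if "r > 0" for r
    unfolding \<phi>_def using radial_integral_deriv[OF w wc[OF that] that, of 0]
    by (auto intro!: derivative_eq_intros)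
  have d2: "(?w has_real_derivative f r - n * ?w r / r) (at r)" if "r > 0" for r
    using radial_integral_deriv[OF f fc[OF that] that] .
  have ev: "\<forall>\<^sub>F r in at_right (0::real). 0 < r \<and> r < 1"
    using eventually_at_right_real[of 0 1] by simp
  have w_bound: "0 \<le> ?w r \<and> ?w r \<le> r * f r" if "r \<ge> 0" for r
    using radial_integral_nonneg[OF f that] radial_integral_le[OF f that] by auto
  have l1: "((\<lambda>r. ?w r / r) \<longlongrightarrow> 0) (at_right 0)"
  proof (rule tendsto_sandwich[OF _ _ tendsto_const lim])
    show "\<forall>\<^sub>F r in at_right 0. 0 \<le> ?w r / r" "\<forall>\<^sub>F r in at_right 0. ?w r / r \<le> f r"
      using ev by (eventually_elim, use w_bound in \<open>force simp: field_simps\<close>)+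
  qed
  have l2: "((\<lambda>r. f r - n * ?w r / r) \<longlongrightarrow> 0) (at_right 0)"
    using tendsto_diff[OF lim tendsto_mult[OF tendsto_const[of "real n"] l1]] by simp
  have l0: "(\<phi> \<longlongrightarrow> \<phi> 0) (at_right 0)"
  proof -
    have "(radial_integral 0 ?w \<longlongrightarrow> 0) (at_right 0)"
    proof (rule tendsto_sandwich[OF _ _ tendsto_const])
      show "\<forall>\<^sub>F r in at_right 0. 0 \<le> radial_integral 0 ?w r"
        using ev by eventually_elim (simp add: radial_integral_nonneg[OF w])
      show "\<forall>\<^sub>F r in at_right 0. radial_integral 0 ?w r \<le> r * ?w 1"
        using ev
      proof eventually_elim
        case (elim r)
        then have "radial_integral 0 ?w r \<le> r * ?w r" using radial_integral_le[OF w] by simp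
        also have "\<dots> \<le> r * ?w 1" using elim nonneg_monoD(2)[OF w] by (intro mult_left_mono) auto
        finally show ?case .
      qed
      show "((\<lambda>r. r * ?w 1) \<longlongrightarrow> 0) (at_right 0)" by (rule tendsto_eq_intros refl | simp)+
    qed
    from tendsto_add[OF tendsto_const[of 1] this] have "(\<phi> \<longlongrightarrow> 1) (at_right 0)"
      unfolding \<phi>_def by simp
    moreover have "\<phi> 0 = 1" by (simp add: \<phi>_def radial_integral_def)
    ultimately show ?thesis by simp
  qed
  have c2: "continuous_on {0<..} (\<lambda>r. f r - n * ?w r / r)"
    by (intro continuous_intros cont continuous_on_radial_integral f) auto
  have F: "F = (\<lambda>x. \<phi> (norm x))" by (simp add: F_def \<phi>_def)
  note ext = radial_extension[OF d1 d2 c2 l0 l1 l2, where 'a = 'a, folded F]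
  show "C2_function F" using ext(1) .
  show "laplacian F x = f (norm x)"
  proof (cases "x = 0")
    case True
    then show ?thesis using ext(2) f0 by simp
  next
    case False
    then show ?thesis
      unfolding F using laplacian_radial[OF d1 d2[of "norm x"]] n by simp
  qed
  show "norm (gradient F x) = ?w (norm x)"
  proof (cases "x = 0")
    case True
    then show ?thesis using ext(3) by (simp add: radial_integral_def)
  next
    case False
    then show ?thesis
      unfolding F using norm_gradient_radial[OF False d1] w_bound[of "norm x"] by simp
  qed
qed

text \<open>The pointwise supremum of all sub-solutions below \<open>V\<close>, as in the Knaster--Tarski theorem.\<close>

lemma monotone_operator_fixpoint:
  fixes T :: "(real \<Rightarrow> real) \<Rightarrow> real \<Rightarrow> real"
  defines "adm \<equiv> \<lambda>f. nonneg_mono f \<and> (\<forall>r\<ge>0. 1 \<le> f r)"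
  assumes adm: "\<And>f. adm f \<Longrightarrow> adm (T f)"
    and mono: "\<And>f g r. adm f \<Longrightarrow> adm g \<Longrightarrow> (\<And>r. r \<ge> 0 \<Longrightarrow> f r \<le> g r) \<Longrightarrow> r \<ge> 0 \<Longrightarrow> T f r \<le> T g r"
    and V: "adm V" "\<And>r. r \<ge> 0 \<Longrightarrow> T V r \<le> V r"
  obtains v where "adm v" "\<And>r. r \<ge> 0 \<Longrightarrow> T v r = v r"
proof -
  define S where "S = {f. adm f \<and> (\<forall>r\<ge>0. f r \<le> V r \<and> f r \<le> T f r)}"
  define v where "v r = (SUP f\<in>S. f r)" for r
  \<comment> \<open>As \<open>T\<close> preserves the lower bound 1, the constant 1 is a
    sub-solution, so the supremum runs over a nonempty set.\<close>
  have one: "(\<lambda>_. 1) \<in> S"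
  proof -
    have 1: "adm (\<lambda>_. 1)" by (auto simp: adm_def intro: nonneg_monoI)
    with adm[OF 1] V(1) show ?thesis by (simp add: S_def adm_def)
  qed
  have bdd: "bdd_above ((\<lambda>f. f r) ` S)" if "r \<ge> 0" for r
    using that by (intro bdd_aboveI[of _ "V r"]) (auto simp: S_def)
  have upper: "f r \<le> v r" if "f \<in> S" "r \<ge> 0" for f r
    unfolding v_def using that bdd by (intro cSUP_upper)
  have least: "v r \<le> c" if "\<And>f. f \<in> S \<Longrightarrow> f r \<le> c" for r c
    unfolding v_def using that one by (intro cSUP_least) auto
  have v1: "1 \<le> v r" if "r \<ge> 0" for r using upper[OF one that] .
  have v: "adm v"
    unfolding adm_def
  proof (intro conjI nonneg_monoI allI impI)
    fix x y :: real assume xy: "0 \<le> x" "x \<le> y"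
    show "v x \<le> v y"
    proof (rule least)
      fix f assume f: "f \<in> S"
      then have "f x \<le> f y" using xy nonneg_monoD(2) by (auto simp: S_def adm_def)
      also have "\<dots> \<le> v y" using upper[OF f] xy by simp
      finally show "f x \<le> v y" .
    qed
  qed (use v1 in force)+
  have vV: "v r \<le> V r" if "r \<ge> 0" for r using that by (intro least) (auto simp: S_def)
  have vT: "v r \<le> T v r" if r: "r \<ge> 0" for r
  proof (rule least)
    fix f assume f: "f \<in> S"
    then have "f r \<le> T f r" using r by (auto simp: S_def)
    also have "\<dots> \<le> T v r" using f v upper[OF f] r by (intro mono) (auto simp: S_def)
    finally show "f r \<le> T v r" .
  qed
  \<comment> \<open>Monotonicity makes \<open>T v\<close> again a sub-solution below
    \<open>V\<close>; hence \<open>T v \<le> v\<close>, the missing inequality.\<close>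
  have "T v \<in> S"
    unfolding S_def
  proof (intro CollectI conjI allI impI adm[OF v])
    fix r :: real assume r: "0 \<le> r"
    show "T v r \<le> V r" using mono[OF v V(1) vV r] V(2)[OF r] by simp
    show "T v r \<le> T (T v) r" using mono[OF v adm[OF v] vT r] .
  qed
  then have "T v r = v r" if "r \<ge> 0" for r
    using upper[of "T v" r] vT[of r] that by simp
  with v that show ?thesis by blast
qed

text \<open>Normalising \<open>v 0 = 1\<close> keeps all candidates at least 1, where
  \<open>y powr (p * s) \<le> y\<close>; this makes the estimate for the super-solution
  linear.\<close>

lemma positive_radial_solution_exists:
  fixes a b p s :: real
  assumes a: "a > 0" and b: "b > 0" and p: "p > 0" and s: "s \<ge> 1" and ps: "p * s \<le> 1"
  shows "\<exists>(u :: 'a::euclidean_space \<Rightarrow> real) v. positive_radial_solution a b p s u v"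
proof -
  obtain n where n: "DIM('a) = Suc n" using DIM_positive[where 'a = 'a] gr0_implies_Suc by blast
  define w where "w f = radial_integral n (\<lambda>r. r powr a * f r powr p)" for f
  define z where "z f = radial_integral n (\<lambda>r. r powr b * w f r powr s)" for f
  define T where "T f r = 1 + radial_integral 0 (z f) r" for f r
  have w: "nonneg_mono (w f)" if "nonneg_mono f" for f
    unfolding w_def using that a p by (intro nonneg_mono_radial_integral nonneg_mono_weight) auto
  have z: "nonneg_mono (z f)" if "nonneg_mono f" for f
    unfolding z_def using w[OF that] b s by (intro nonneg_mono_radial_integral nonneg_mono_weight) auto
  have w_mono: "w f r \<le> w g r"
    if "nonneg_mono f" "nonneg_mono g" "\<And>r. r \<ge> 0 \<Longrightarrow> f r \<le> g r" "r \<ge> 0" for f g r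
    unfolding w_def using that a p nonneg_monoD(1)[OF that(1)]
    by (intro radial_integral_mono nonneg_mono_weight mult_left_mono powr_mono2) auto
  have z_mono: "z f r \<le> z g r"
    if "nonneg_mono f" "nonneg_mono g" "\<And>r. r \<ge> 0 \<Longrightarrow> f r \<le> g r" "r \<ge> 0" for f g r
    unfolding z_def using that b s w w_mono[OF that(1-3)] nonneg_monoD(1)[OF w[OF that(1)]]
    by (intro radial_integral_mono nonneg_mono_weight mult_left_mono powr_mono2) auto
  \<comment> \<open>\<open>c - 1\<close> collects the powers of \<open>r\<close> in
    \<open>r * (r powr b * (r * r powr a) powr s)\<close>, the bound for \<open>z\<close> up to the
    factor \<open>V r powr (p * s)\<close>.\<close>
  define c where "c = 2 + b + s * (1 + a)"
  have c: "c > 1" using a b s by (simp add: c_def add_pos_nonneg)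
  define V where "V r = exp (r powr c / c)" for r
  have V1: "1 \<le> V r" if "r \<ge> 0" for r using c that by (simp add: V_def)
  have V: "nonneg_mono V"
    using c by (intro nonneg_monoI) (auto simp: V_def intro!: divide_right_mono powr_mono2)
  have zV: "z V r \<le> r powr (c - 1) * V r" if r: "r \<ge> 0" for r
  proof (cases "r = 0")
    case False
    then have r: "r > 0" using that by simp
    have "z V r \<le> r * (r powr b * w V r powr s)"
      unfolding z_def using w[OF V] b s r by (intro radial_integral_le nonneg_mono_weight) auto
    also have "\<dots> \<le> r * (r powr b * (r * (r powr a * V r powr p)) powr s)"
    proof (intro mult_left_mono powr_mono2)
      show "w V r \<le> r * (r powr a * V r powr p)"
        unfolding w_def using V a p r by (intro radial_integral_le nonneg_mono_weight) auto
      show "0 \<le> w V r" using nonneg_monoD(1)[OF w[OF V]] r by simp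
    qed (use r s in auto)
    also have "\<dots> = r powr (1 + (b + (s + a * s))) * V r powr (p * s)"
      using r V1[of r] by (simp add: powr_mult powr_powr powr_add mult_ac)
    \<comment> \<open>The hypothesis \<open>p * s \<le> 1\<close> enters here, together with
      \<open>1 \<le> V r\<close>.\<close>
    also have "\<dots> \<le> r powr (1 + (b + (s + a * s))) * V r powr 1"
      using r V1[of r] ps by (intro mult_left_mono powr_mono) auto
    also have "1 + (b + (s + a * s)) = c - 1" by (simp add: c_def algebra_simps)
    finally show ?thesis using V1[of r] r by simp
  qed (simp add: z_def radial_integral_def)
  have TV: "T V r \<le> V r" if r: "r \<ge> 0" for r
  proof -
    have V_int: "((\<lambda>r. r powr (c - 1) * V r) has_integral V r - V 0) {0..r}"
    proof (rule fundamental_theorem_of_calculus_interior[OF r])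
      show "continuous_on {0..r} V"
        unfolding V_def using c by (intro continuous_intros continuous_on_powr') auto
      fix x assume "x \<in> {0<..<r}"
      then show "(V has_vector_derivative x powr (c - 1) * V x) (at x)"
        unfolding V_def has_real_derivative_iff_has_vector_derivative[symmetric]
        using c by (auto intro!: derivative_eq_intros)
    qed
    have "(z V has_integral integral {0..r} (z V)) {0..r}"
      using integrable_weight[OF z[OF V], of 0 r] by (simp add: integrable_integral)
    from has_integral_le[OF this V_int zV] have "integral {0..r} (z V) \<le> V r - V 0" by simp
    then show ?thesis
      using radial_integral_eq[OF z[OF V] r, of 0] c by (simp add: T_def V_def)
  qed
  obtain v where v: "nonneg_mono v" "\<And>r. r \<ge> 0 \<Longrightarrow> 1 \<le> v r" "\<And>r. r \<ge> 0 \<Longrightarrow> T v r = v r"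
  proof (rule monotone_operator_fixpoint[of T V])
    fix f assume "nonneg_mono f \<and> (\<forall>r\<ge>0. 1 \<le> f r)"
    then have f: "nonneg_mono (radial_integral 0 (z f))" by (intro nonneg_mono_radial_integral z) auto
    show "nonneg_mono (T f) \<and> (\<forall>r\<ge>0. 1 \<le> T f r)"
      unfolding T_def using nonneg_monoD[OF f] by (auto intro!: nonneg_monoI add_nonneg_nonneg)
  next
    fix f g :: "real \<Rightarrow> real" and r :: real
    assume "nonneg_mono f \<and> (\<forall>r\<ge>0. 1 \<le> f r)" "nonneg_mono g \<and> (\<forall>r\<ge>0. 1 \<le> g r)"
      "\<And>r. r \<ge> 0 \<Longrightarrow> f r \<le> g r" "r \<ge> 0"
    then show "T f r \<le> T g r"
      unfolding T_def by (intro add_left_mono radial_integral_mono z z_mono) auto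
  qed (use V V1 TV in auto)
  let ?f = "\<lambda>r. r powr a * v r powr p"
  let ?g = "\<lambda>r. r powr b * w v r powr s"
  have f: "nonneg_mono ?f" and g: "nonneg_mono ?g"
    using v(1) w[OF v(1)] a b p s by (intro nonneg_mono_weight; simp)+
  have cw: "continuous_on {0<..} (w v)"
    unfolding w_def by (rule continuous_on_radial_integral[OF f])
  \<comment> \<open>The right side of the fixed-point equation is continuous for every monotone
    \<open>v\<close>, so the solution inherits continuity from it.\<close>
  have "continuous_on {0<..} (\<lambda>r. 1 + radial_integral 0 (z v) r)"
    by (intro continuous_intros continuous_on_radial_integral z v)
  then have cv: "continuous_on {0<..} v"
    by (rule continuous_on_cong[THEN iffD1, rotated 2]) (use v(3) in \<open>auto simp: T_def\<close>)
  \<comment> \<open>A monotone \<open>h\<close> is bounded near 0 by \<open>h 1\<close>, so the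
    factor \<open>r powr \<alpha>\<close> makes the source terms vanish at the origin.\<close>
  have lim: "((\<lambda>r. r powr \<alpha> * h r powr q) \<longlongrightarrow> 0) (at_right 0)"
    if h: "nonneg_mono h" and "\<alpha> > 0" "q > 0" for h :: "real \<Rightarrow> real" and \<alpha> q
  proof (rule tendsto_sandwich[OF _ _ tendsto_const])
    show "\<forall>\<^sub>F r in at_right 0. 0 \<le> r powr \<alpha> * h r powr q" by simp
    have "\<forall>\<^sub>F r in at_right (0::real). 0 < r \<and> r < 1"
      using eventually_at_right_real[of 0 1] by simp
    then show "\<forall>\<^sub>F r in at_right 0. r powr \<alpha> * h r powr q \<le> r powr \<alpha> * h 1 powr q"
      by eventually_elim (use that(3) nonneg_monoD[OF h] in \<open>auto intro!: mult_left_mono powr_mono2\<close>)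
    have "((\<lambda>r::real. r powr \<alpha> * h 1 powr q) \<longlongrightarrow> 0 powr \<alpha> * h 1 powr q) (at_right 0)"
      using that(2)
      by (intro tendsto_intros tendsto_powr') (auto intro: eventually_mono[OF eventually_at_right_less])
    then show "((\<lambda>r. r powr \<alpha> * h 1 powr q) \<longlongrightarrow> 0) (at_right 0)" using that(2) by simp
  qed
  \<comment> \<open>The system involves \<open>u\<close> only through its derivatives, so a constant
    may be added to make it positive.\<close>
  define uu :: "'a \<Rightarrow> real" where "uu = (\<lambda>x. 1 + radial_integral 0 (radial_integral n ?f) (norm x))"
  define vv :: "'a \<Rightarrow> real" where "vv = (\<lambda>x. 1 + radial_integral 0 (radial_integral n ?g) (norm x))"
  have cf: "continuous_on {0<..} ?f"
  proof (intro continuous_intros cv ballI)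
    fix r :: real assume "r \<in> {0<..}"
    then show "v r \<noteq> 0" using v(2)[of r] by simp
  qed simp
  have cg: "continuous_on {0<..} ?g"
    using s by (intro continuous_intros continuous_on_powr' cw) (auto intro!: nonneg_monoD(1)[OF w[OF v(1)]])
  note U = radial_Poisson[OF f cf _ lim[OF v(1) a p] n, folded uu_def]
  note W = radial_Poisson[OF g cg _ lim[OF w[OF v(1)] b] n, folded vv_def]
  have vv: "vv x = v (norm x)" for x
    using v(3)[of "norm x"] by (simp add: vv_def T_def z_def)
  have uu: "uu x > 0" for x
    unfolding uu_def by (intro add_pos_nonneg radial_integral_nonneg nonneg_mono_radial_integral f) auto
  have vp: "vv x > 0" for x using v(2)[of "norm x"] by (simp add: vv)
  have "positive_radial_solution a b p s uu vv"
    unfolding positive_radial_solution_def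
  proof (intro conjI allI)
    show "radially_symmetric uu" "radially_symmetric vv"
      by (simp_all add: radially_symmetric_def uu_def vv_def)
    show "laplacian uu x = norm x powr a * vv x powr p" for x
      using U(2) by (simp add: vv)
    show "laplacian vv x = norm x powr b * norm (gradient uu x) powr s" for x
      using U(3) W(2) s by (simp add: w_def)
  qed (use U W uu vp s in auto)
  then show ?thesis by blast
qed

section \<open>Reduction to the radial system\<close>

text \<open>By radial symmetry any axis \<open>e\<close> serves. The profiles are restrictions to a
  line through the origin, so their behaviour at 0 follows from the regularity on the whole
  space.\<close>

lemma positive_radial_solution_profiles:
  fixes u v :: "'a::euclidean_space \<Rightarrow> real"
  assumes sol: "positive_radial_solution a b p s u v"
    and pos: "a > 0" "b > 0" "p > 0" "s \<ge> 1" and n: "DIM('a) = Suc n"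
  obtains U V w z where "radial_solution n a b p s V w z"
    "\<And>x. u x = U (norm x)" "\<And>x. v x = V (norm x)"
    "\<And>r. (U has_real_derivative w r) (at r)"
proof -
  obtain e :: 'a where e: "e \<in> Basis" using nonempty_Basis by blast
  have norm_e: "norm e = 1" using e by (rule norm_Basis)
  have u: "C2_function u" "radially_symmetric u" and v: "C2_function v" "radially_symmetric v"
    and vp: "\<And>x. v x > 0" and eq: "\<And>x. laplacian u x = norm x powr a * v x powr p"
      "\<And>x. laplacian v x = norm x powr b * norm (gradient u x) powr s"
    using sol by (auto simp: positive_radial_solution_def)
  note pu = radial_profile[OF u e n] and pv = radial_profile[OF v e n]
  have "radial_solution n a b p s (\<lambda>r. v (r *\<^sub>R e)) (\<lambda>r. partial e u (r *\<^sub>R e)) (\<lambda>r. partial e v (r *\<^sub>R e))"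
  proof
    show "((\<lambda>r. v (r *\<^sub>R e)) \<longlongrightarrow> v (0 *\<^sub>R e)) (at_right 0)"
      using DERIV_isCont[OF pv(2)[of 0]] unfolding isCont_def by (rule tendsto_within_subset) simp
    fix r :: real assume r: "r > 0"
    show "((\<lambda>r. r ^ n * partial e u (r *\<^sub>R e)) has_real_derivative
        r ^ n * (r powr a * v (r *\<^sub>R e) powr p)) (at r)"
      using pu(4)[OF r] r norm_e by (simp add: eq)
    show "((\<lambda>r. r ^ n * partial e v (r *\<^sub>R e)) has_real_derivative
        r ^ n * (r powr b * \<bar>partial e u (r *\<^sub>R e)\<bar> powr s)) (at r)"
      using pv(4)[OF r] r norm_e by (simp add: eq pu(5))
  qed (use pos vp pu(3) pv(2,3) in auto)
  then show ?thesis
    by (rule that[where U = "\<lambda>r. u (r *\<^sub>R e)"]) (rule pu(1) pv(1) pu(2))+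
qed

theorem theorem2p3:
  fixes a b p s :: real
  assumes "a > 0" and "b > 0" and "p > 0" and "s \<ge> 1"
  shows
    "((\<exists>(u :: real ^ 'n \<Rightarrow> real) v. positive_radial_solution a b p s u v)
        \<longleftrightarrow> p * s - 1 \<le> 0) \<and>
     (p < 1 \<longrightarrow> p * s < 1 \<longrightarrow>
       (\<forall>(u :: real ^ 'n \<Rightarrow> real) v. positive_radial_solution a b p s u v \<longrightarrow>
         (let N = real CARD('n);
              A = 2 + (b + s * (1 + a + 2 * p)) / (1 - p * s);
              B = N + a + p * (2 + (b + s * (1 + a + 2 * p)) / (1 - p * s));
              K = N + (b + s * (1 + a + 2 * p)) / (1 - p * s);
              D = 2 + a + p * (2 + (b + s * (1 + a + 2 * p)) / (1 - p * s))
          in p * (s - 2) * (s + a * s + b + 2) / (1 - p * s) \<le> 2 * (N + a - 1) \<longrightarrow>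
             ((\<lambda>x. u x / norm x powr
                 (((a + 2) * (1 - p * s) + p * s * (a + 1) + b * p + 2 * p) / (1 - p * s)))
               \<longlongrightarrow> (A * B powr s * K) powr (p / (p * s - 1)) / (D * B)) at_infinity \<and>
             ((\<lambda>x. v x / norm x powr (((a + 1) * s + b + 2) / (1 - p * s)))
               \<longlongrightarrow> (A * B powr s * K) powr (1 / (p * s - 1))) at_infinity)))"
proof (intro conjI impI allI)
  have N: "DIM(real ^ 'n) = Suc (CARD('n) - 1)" by simp
  show "(\<exists>(u :: real ^ 'n \<Rightarrow> real) v. positive_radial_solution a b p s u v) \<longleftrightarrow> p * s - 1 \<le> 0"
  proof
    assume "\<exists>(u :: real ^ 'n \<Rightarrow> real) v. positive_radial_solution a b p s u v"
    then obtain u v :: "real ^ 'n \<Rightarrow> real" where "positive_radial_solution a b p s u v" by blast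
    from positive_radial_solution_profiles[OF this assms N] obtain V w z
      where "radial_solution (CARD('n) - 1) a b p s V w z" by metis
    then show "p * s - 1 \<le> 0" using radial_solution.global_imp_le_1 by fastforce
  next
    assume "p * s - 1 \<le> 0"
    then show "\<exists>(u :: real ^ 'n \<Rightarrow> real) v. positive_radial_solution a b p s u v"
      using assms by (intro positive_radial_solution_exists) auto
  qed
  fix u v :: "real ^ 'n \<Rightarrow> real"
  assume ps: "p * s < 1" and sol: "positive_radial_solution a b p s u v"
  obtain U V w z where rs: "radial_solution (CARD('n) - 1) a b p s V w z"
    and u: "\<And>x. u x = U (norm x)" and v: "\<And>x. v x = V (norm x)"
    and U: "\<And>r. (U has_real_derivative w r) (at r)"
    by (rule positive_radial_solution_profiles[OF sol assms N]) (rule that)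
  interpret subcritical_radial_solution "CARD('n) - 1" a b p s V w z
    using rs ps by (intro subcritical_radial_solution.intro subcritical_radial_solution_axioms.intro)
  have card: "real (CARD('n) - 1) = real CARD('n) - 1" by (simp add: of_nat_diff)
  have norm_lim: "LIM x at_infinity. norm (x :: real ^ 'n) :> at_top" by (rule filterlim_norm_at_top)
  have A: "2 + (b + s * (1 + a + 2 * p)) / (1 - p * s) = \<sigma>"
    using ps by (simp add: \<sigma>_def field_simps)
  \<comment> \<open>After rewriting with \<open>A\<close>, the bare fraction survives only in the K
    of the theorem; this fact removes it there.\<close>
  have A': "(b + s * (1 + a + 2 * p)) / (1 - p * s) = \<sigma> - 2" using A by simp
  have B: "real CARD('n) + a + p * \<sigma> = \<beta>" unfolding \<beta>_def card by simp
  have K: "real CARD('n) + (\<sigma> - 2) = \<kappa>" unfolding \<kappa>_def card by simp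
  have e1: "((a + 2) * (1 - p * s) + p * s * (a + 1) + b * p + 2 * p) / (1 - p * s) = 2 + a + p * \<sigma>"
    using ps by (simp add: \<sigma>_def field_simps)
  have e2: "((a + 1) * s + b + 2) / (1 - p * s) = \<sigma>"
    by (simp add: \<sigma>_def algebra_simps)
  have Lp: "L powr p = (\<sigma> * \<beta> powr s * \<kappa>) powr (p / (p * s - 1))"
    by (simp only: L_def powr_powr times_divide_eq_left mult_1)
  have "((\<lambda>x. u x / norm x powr (2 + a + p * \<sigma>)) \<longlongrightarrow> L powr p / ((2 + a + p * \<sigma>) * \<beta>)) at_infinity"
    using filterlim_compose[OF u_asymptotics[OF U] norm_lim] by (simp add: u mult.commute)
  moreover have "((\<lambda>x. v x / norm x powr \<sigma>) \<longlongrightarrow> L) at_infinity"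
    using filterlim_compose[OF v_asymptotics norm_lim] by (simp add: v)
  ultimately show "let N = real CARD('n);
              A = 2 + (b + s * (1 + a + 2 * p)) / (1 - p * s);
              B = N + a + p * (2 + (b + s * (1 + a + 2 * p)) / (1 - p * s));
              K = N + (b + s * (1 + a + 2 * p)) / (1 - p * s);
              D = 2 + a + p * (2 + (b + s * (1 + a + 2 * p)) / (1 - p * s))
          in p * (s - 2) * (s + a * s + b + 2) / (1 - p * s) \<le> 2 * (N + a - 1) \<longrightarrow>
             ((\<lambda>x. u x / norm x powr
                 (((a + 2) * (1 - p * s) + p * s * (a + 1) + b * p + 2 * p) / (1 - p * s)))
               \<longlongrightarrow> (A * B powr s * K) powr (p / (p * s - 1)) / (D * B)) at_infinity \<and>
             ((\<lambda>x. v x / norm x powr (((a + 1) * s + b + 2) / (1 - p * s)))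
               \<longlongrightarrow> (A * B powr s * K) powr (1 / (p * s - 1))) at_infinity"
    unfolding Let_def A e1 e2 unfolding A' B K Lp[symmetric] L_def[symmetric]
    by (intro impI conjI)
qed

end
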